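(* Let $d\ge2$. There exist ergodic diagonal measures on $X^d$ which are not graph joinings. More precisely, if $(n_0,D,\tau)\in\mathscr{D}$ is such that the corner case occurs infinitely often (that is, $\{1,3\}\subset\{\tau_n(i):1\le i\le d\}$ for infinitely many $n\ge n_0$), then the ergodic diagonal measure $\sigma_{(n_0,D,\tau)}$ is not a graph joining, and it is concentrated on a set $N_1\times N_2\times\cdots\times N_d$ where each $N_i\subset X$, $1\le i\le d$, is $\mu$-negligible. Such a measure is conservative (for $T^{\times d}$) whenever the central case occurs infinitely often (that is, $\tau_n=(1,\ldots,1)$ for infinitely many $n$).
   Context: Construction of $T$ (Chacon infinite transformation). Let $X=\mathbb{R}_+=[0,\infty)$ with its Borel $\sigma$-algebra and Lebesgue measure $\mu$. Tower $0$ is the single interval $[0,1)$, of height $h_0=1$. For $n\ge0$, given tower $n$, a stack of $h_n$ disjoint intervals (called levels) of length $3^{-n}$, each closed on the left and open on the right, step $n+1$ is: cut tower $n$ vertically into three subcolumns of equal width (first, second, third from left to right); put one extra interval of length $3^{-(n+1)}$ above the second (middle) subcolumn and $3h_n+1$ extra intervals of length $3^{-(n+1)}$ above the third subcolumn (extra intervals are picked successively, each time taking the leftmost interval of the desired length in the unused part of $\mathbb{R}_+$); then stack the three subcolumns, left under right, to get tower $n+1$, of height $h_{n+1}=2(3h_n+1)$. In each tower, $T$ maps each point not in the top level to the point exactly above it. This defines $T:X\to X$, which preserves $\mu$; it is injective with image $X\setminus\{0\}$. $T^{-1}A$ denotes the preimage of a set. Define $T^{\times d}(x_1,\ldots,x_d)=(Tx_1,\ldots,Tx_d)$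 on $X^d$. For $n\ge1$, $C_n$ is the union of the $h_n/2$ lowest levels of tower $n$; $C_0=\emptyset$; $C_n\subset C_{n+1}$, $X=\bigcup_nC_n$. For $x$ in tower $n$, $t_n(x)\in\{1,2,3\}$ indicates whether $x$ belongs to the first, second or third subcolumn of tower $n$. A measure $\sigma$ on $X^d$ is boundedly finite if $\sigma(A)<\infty$ for every bounded measurable $A$. An $n$-box is a product $L_1\times\cdots\times L_d$ where each $L_j$ is a level of $C_n$. An $n$-diagonal is a finite family of $n$-boxes $B,T^{\times d}B,\ldots,(T^{\times d})^{\ell}B$ which is maximal: $(T^{\times d})^{-1}B\not\subset C_n^d$ and $(T^{\times d})^{\ell+1}B\not\subset C_n^d$; it is identified with the union of its boxes. A boundedly finite $T^{\times d}$-invariant measure $\sigma$ on $X^d$ is a diagonal measure if there is $n_0$ such that for all $n\ge n_0$, $\sigma|_{C_n^d}$ is concentrated on a single $n$-diagonal. For a (nonzero) diagonal measure, $n_0(\sigma)$ is the smallest integer $n_0$ such that $\sigma(C_{n_0-1}^d)>0$ and for each $n\ge n_0$, $\sigma$ gives positive measure to a single $n$-diagonal, denoted $D_n(\sigma)$. For an $n$-box $B$ and $\tau\in\{1,2,3\}^d$, $B(\tau)=\{x\in B: t_n(x_i)=\tau(i)\ \forall i\}$ is an $(n+1)$-box. For an $n$-diagonal $D$, $D(\tau)$ is the unique $(n+1)$-diagonal containing $B(\tau)$ for all $n$-boxes $B$ of $D$. An $n_0$-diagonal $D$ is initial if either at least two $(n_0-1)$-diagonals have non-empty intersection with $D$,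 or $D$ has non-empty intersection with exactly one $(n_0-1)$-diagonal but does not intersect $C_{n_0-2}^d$. The parameter set $\mathscr{D}$ is the set of $(n_0,D,\tau)$ with $n_0\ge1$, $D$ an initial $n_0$-diagonal, $\tau=(\tau_n)_{n\ge n_0}$, $\tau_n\in\{1,2,3\}^d$, such that for each $n$ either $\{1,3\}\subset\{\tau_n(i):1\le i\le d\}$ (corner case) or $\tau_n(i)=1$ for all $i$ (central case), and such that for all $1\le i\le d$ there are infinitely many $n$ with $\tau_n(i)\in\{1,2\}$. For $(n_0,D,\tau)\in\mathscr{D}$, set $D_{n_0}=D$ and $D_{n+1}=D_n(\tau_n)$; $\sigma_{(n_0,D,\tau)}$ denotes the unique diagonal measure $\sigma$ with $n_0(\sigma)\le n_0$, $D_n(\sigma)=D_n$ for all $n\ge n_0$, and $\sigma(C_{n_0}^d)=1$ (it exists and is ergodic). A measure $\sigma$ on $X^d$ is a graph joining if there exist a real $\alpha>0$ and $\mu$-preserving transformations $S_2,\ldots,S_d$ of $X$ commuting with $T$ such that $\sigma(A_1\times\cdots\times A_d)=\alpha\,\mu(A_1\cap S_2^{-1}A_2\cap\cdots\cap S_d^{-1}A_d)$ for all measurable $A_1,\ldots,A_d$. *)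

theory Defs
  imports "HOL-Analysis.Analysis"
begin

section \<open>The Chacon infinite transformation\<close>

text \<open>
  Tower \<open>n\<close> is represented by the list of the left endpoints of its levels, from bottom to top;
  every level is an interval of length \<open>1/3^n\<close>. Tower \<open>n\<close> occupies exactly the interval
  from \<open>0\<close> to \<open>h / 3^n\<close>, where \<open>h\<close> is its height (lemma \<open>tower_occupies\<close> below). So the
  leftmost unused intervals of length \<open>w = 1/3^(n+1)\<close>, taken successively, start at
  \<open>h / 3^n\<close>, \<open>h / 3^n + w\<close>, \<open>h / 3^n + 2 * w\<close>, and so on: the first one
  goes above the middle subcolumn, the next \<open>3 * h + 1\<close> above the third subcolumn.
\<close>

primrec tower :: "nat \<Rightarrow> real list" where
  "tower 0 = [0]"
| "tower (Suc n) =
    (let L = tower n; w = 1 / 3 ^ Suc n; u = real (length L) / 3 ^ n in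
       L
     @ (map (\<lambda>a. a + w) L @ [u])
     @ (map (\<lambda>a. a + 2 * w) L @ map (\<lambda>k. u + real (Suc k) * w) [0..<3 * length L + 1]))"

definition height :: "nat \<Rightarrow> nat" where
  "height n = length (tower n)"

definition level :: "nat \<Rightarrow> nat \<Rightarrow> real set" where
  "level n i = {tower n ! i ..< tower n ! i + 1 / 3 ^ n}"

lemma height_0: "height 0 = 1"
  by (simp add: height_def)

lemma height_Suc: "height (Suc n) = 2 * (3 * height n + 1)"
  by (simp add: height_def Let_def)

lemma UN_consecutive:
  fixes u w :: real
  assumes "w > 0"
  shows "(\<Union>k<m. {u + real k * w ..< u + real k * w + w}) = {u ..< u + real m * w}"
proof (induction m)
  case (Suc m)
  have "0 \<le> real m * w" using assms by simp
  then have "{u ..< u + real m * w} \<union> {u + real m * w ..< u + real m * w + w}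
      = {u ..< u + real m * w + w}"
    using assms by (intro ivl_disj_un) auto
  then show ?case using Suc
    by (simp add: lessThan_Suc Un_commute distrib_right add.assoc add.commute[of w])
qed simp

lemma tower_occupies: "(\<Union>i<height n. level n i) = {0 ..< real (height n) / 3 ^ n}"
proof -
  have idx: "(\<Union>i<height n. level n i) = (\<Union>a\<in>set (tower n). {a ..< a + 1 / 3 ^ n})" for n
    by (auto simp: level_def height_def set_conv_nth)
  have "(\<Union>a\<in>set (tower n). {a ..< a + 1 / 3 ^ n}) = {0 ..< real (height n) / 3 ^ n}"
  proof (induction n)
    case 0
    then show ?case by (simp add: height_def)
  next
    case (Suc n)
    define w :: real where "w = 1 / 3 ^ Suc n"
    define u :: real where "u = real (height n) / 3 ^ n"
    have w: "w > 0" "1 / 3 ^ n = 3 * w" by (auto simp: w_def)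
    have u: "u \<ge> 0" "u = real (height n) * (3 * w)" by (auto simp: u_def w_def)
    define K where "K = 3 * height n + 2"
    have ivl: "{a ..< a + w} \<union> {a + w ..< a + w + w} \<union> {a + 2 * w ..< a + 2 * w + w}
        = {a ..< a + 3 * w}" for a :: real
      using w by auto
    have st: "set (tower (Suc n)) = set (tower n) \<union> (\<lambda>a. a + w) ` set (tower n)
        \<union> (\<lambda>a. a + 2 * w) ` set (tower n) \<union> (\<lambda>k. u + real k * w) ` {..<K}"
    proof -
      have "{..<K} = insert 0 (Suc ` {0..<3 * height n + 1})"
        by (simp add: K_def image_Suc_atLeastLessThan lessThan_atLeast0) auto
      then have "(\<lambda>k. u + real k * w) ` {..<K}
          = insert u ((\<lambda>k. u + real (Suc k) * w) ` {0..<3 * height n + 1})"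
        by (simp only: image_insert image_image of_nat_0 mult_zero_left add_0_right)
      moreover have "tower (Suc n) = tower n @ (map (\<lambda>a. a + w) (tower n) @ [u])
          @ (map (\<lambda>a. a + 2 * w) (tower n)
            @ map (\<lambda>k. u + real (Suc k) * w) [0..<3 * height n + 1])"
        unfolding w_def u_def height_def by (simp only: tower.simps Let_def)
      ultimately show ?thesis
        by (simp only: set_append set_map set_upt list.set) blast
    qed
    have "(\<Union>a\<in>set (tower (Suc n)). {a ..< a + w})
        = (\<Union>a\<in>set (tower n). {a ..< a + w} \<union> {a + w ..< a + w + w} \<union> {a + 2 * w ..< a + 2 * w + w})
          \<union> (\<Union>k<K. {u + real k * w ..< u + real k * w + w})"
      unfolding st by blast
    also have "\<dots> = {0 ..< u} \<union> {u ..< u + real K * w}"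
      unfolding ivl UN_consecutive[OF w(1)] using Suc w(2) by (simp add: u_def)
    also have "\<dots> = {0 ..< u + real K * w}" using u(1) w(1) by (intro ivl_disj_un) auto
    also have "u + real K * w = real (height (Suc n)) / 3 ^ Suc n"
      unfolding u(2) K_def height_Suc w_def by (simp add: field_simps)
    finally show ?case unfolding w_def .
  qed
  then show ?thesis using idx by simp
qed

definition mu :: "real measure" where
  "mu = restrict_space lborel {0..}"

definition T :: "real \<Rightarrow> real" where
  "T x = (THE y. \<exists>n i. Suc i < height n \<and> x \<in> level n i
                    \<and> y = x - tower n ! i + tower n ! Suc i)"

text \<open>As \<open>height 0 = 1\<close>, this gives \<open>C 0 = {}\<close>.\<close>

definition C :: "nat \<Rightarrow> real set" where
  "C n = (\<Union>i<height n div 2. level n i)"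

definition subcolumn :: "nat \<Rightarrow> nat \<Rightarrow> real set" where
  "subcolumn n k = (\<Union>i<height n.
     {tower n ! i + (real k - 1) / 3 ^ Suc n ..< tower n ! i + real k / 3 ^ Suc n})"

definition t :: "nat \<Rightarrow> real \<Rightarrow> nat" where
  "t n x = (THE k. k \<in> {1, 2, 3} \<and> x \<in> subcolumn n k)"


section \<open>General notions for a transformation of a measure space\<close>

definition preserves :: "'a measure \<Rightarrow> ('a \<Rightarrow> 'a) \<Rightarrow> bool" where
  "preserves M f \<longleftrightarrow> f \<in> measurable M M \<and>
     (\<forall>A\<in>sets M. emeasure M (f -` A \<inter> space M) = emeasure M A)"

definition ergodic :: "'a measure \<Rightarrow> ('a \<Rightarrow> 'a) \<Rightarrow> bool" where
  "ergodic M f \<longleftrightarrow> preserves M f \<and>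
     (\<forall>A\<in>sets M. f -` A \<inter> space M = A \<longrightarrow> emeasure M A = 0 \<or> emeasure M (space M - A) = 0)"

text \<open>Conservativity: every (measurable) wandering set is negligible.\<close>

definition conservative :: "'a measure \<Rightarrow> ('a \<Rightarrow> 'a) \<Rightarrow> bool" where
  "conservative M f \<longleftrightarrow>
     (\<forall>W\<in>sets M. disjoint_family (\<lambda>n. (f ^^ n) -` W \<inter> space M) \<longrightarrow> emeasure M W = 0)"

definition concentrated_on :: "'a measure \<Rightarrow> 'a set \<Rightarrow> bool" where
  "concentrated_on M S \<longleftrightarrow> (AE x in M. x \<in> S)"


section \<open>Measures on the Cartesian power\<close>

text \<open>
  Points of \<open>X^d\<close> are the extensional functions from \<open>{1..d}\<close> to the nonnegative reals.
  Only the space and the \<open>\<sigma>\<close>-algebra of \<open>Xpow d\<close> are used below.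
\<close>

definition Xpow :: "nat \<Rightarrow> (nat \<Rightarrow> real) measure" where
  "Xpow d = PiM {1..d} (\<lambda>_. mu)"

definition Tpow :: "nat \<Rightarrow> (nat \<Rightarrow> real) \<Rightarrow> (nat \<Rightarrow> real)" where
  "Tpow d x = (\<lambda>i\<in>{1..d}. T (x i))"

definition Cpow :: "nat \<Rightarrow> nat \<Rightarrow> (nat \<Rightarrow> real) set" where
  "Cpow d n = PiE {1..d} (\<lambda>_. C n)"

definition boundedly_finite :: "nat \<Rightarrow> (nat \<Rightarrow> real) measure \<Rightarrow> bool" where
  "boundedly_finite d \<sigma> \<longleftrightarrow>
     (\<forall>A\<in>sets (Xpow d). (\<exists>r. \<forall>x\<in>A. \<forall>i\<in>{1..d}. x i \<le> r) \<longrightarrow> emeasure \<sigma> A < \<infinity>)"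

definition is_box :: "nat \<Rightarrow> nat \<Rightarrow> (nat \<Rightarrow> real) set \<Rightarrow> bool" where
  "is_box d n B \<longleftrightarrow>
     (\<exists>j. (\<forall>i\<in>{1..d}. j i < height n div 2) \<and> B = PiE {1..d} (\<lambda>i. level n (j i)))"

text \<open>A diagonal is kept as the family of its boxes; \<open>\<Union>D\<close> is the corresponding subset of \<open>X^d\<close>.\<close>

definition is_diagonal :: "nat \<Rightarrow> nat \<Rightarrow> (nat \<Rightarrow> real) set set \<Rightarrow> bool" where
  "is_diagonal d n D \<longleftrightarrow>
     (\<exists>B l. D = {(Tpow d ^^ k) ` B | k. k \<le> l}
        \<and> (\<forall>k\<le>l. is_box d n ((Tpow d ^^ k) ` B))
        \<and> \<not> (Tpow d -` B \<inter> space (Xpow d) \<subseteq> Cpow d n)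
        \<and> \<not> ((Tpow d ^^ (l + 1)) ` B \<subseteq> Cpow d n))"

definition diagonal_measure :: "nat \<Rightarrow> (nat \<Rightarrow> real) measure \<Rightarrow> bool" where
  "diagonal_measure d \<sigma> \<longleftrightarrow>
     sets \<sigma> = sets (Xpow d) \<and> boundedly_finite d \<sigma> \<and> preserves \<sigma> (Tpow d) \<and>
     (\<exists>n0. \<forall>n\<ge>n0. \<exists>D. is_diagonal d n D \<and> concentrated_on (restrict_space \<sigma> (Cpow d n)) (\<Union>D))"

text \<open>\<open>n0_of\<close> and \<open>D_of\<close> are meant for nonzero diagonal measures. The truncated \<open>0 - 1\<close> is
  harmless in \<open>n0_of\<close>, since \<open>C 0\<close> is empty.\<close>

definition n0_of :: "nat \<Rightarrow> (nat \<Rightarrow> real) measure \<Rightarrow> nat" where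
  "n0_of d \<sigma> = (LEAST n0. emeasure \<sigma> (Cpow d (n0 - 1)) > 0 \<and>
     (\<forall>n\<ge>n0. \<exists>!D. is_diagonal d n D \<and> emeasure \<sigma> (\<Union>D) > 0))"

definition D_of :: "nat \<Rightarrow> (nat \<Rightarrow> real) measure \<Rightarrow> nat \<Rightarrow> (nat \<Rightarrow> real) set set" where
  "D_of d \<sigma> n = (THE D. is_diagonal d n D \<and> emeasure \<sigma> (\<Union>D) > 0)"

definition graph_joining :: "nat \<Rightarrow> (nat \<Rightarrow> real) measure \<Rightarrow> bool" where
  "graph_joining d \<sigma> \<longleftrightarrow> sets \<sigma> = sets (Xpow d) \<and>
     (\<exists>(\<alpha>::real) S. \<alpha> > 0 \<and>
        (\<forall>i\<in>{2..d}. preserves mu (S i) \<and> (AE x in mu. S i (T x) = T (S i x))) \<and>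
        (\<forall>A. (\<forall>i\<in>{1..d}. A i \<in> sets mu) \<longrightarrow>
           emeasure \<sigma> (PiE {1..d} A)
             = ennreal \<alpha> * emeasure mu (A 1 \<inter> (\<Inter>i\<in>{2..d}. S i -` A i))))"


section \<open>Parametrization of diagonal measures\<close>

definition subbox :: "nat \<Rightarrow> nat \<Rightarrow> (nat \<Rightarrow> real) set \<Rightarrow> (nat \<Rightarrow> nat) \<Rightarrow> (nat \<Rightarrow> real) set" where
  "subbox d n B \<tau> = {x\<in>B. \<forall>i\<in>{1..d}. t n (x i) = \<tau> i}"

definition next_diagonal ::
    "nat \<Rightarrow> nat \<Rightarrow> (nat \<Rightarrow> real) set set \<Rightarrow> (nat \<Rightarrow> nat) \<Rightarrow> (nat \<Rightarrow> real) set set" where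
  "next_diagonal d n D \<tau> = (THE E. is_diagonal d (Suc n) E \<and> (\<forall>B\<in>D. subbox d n B \<tau> \<subseteq> \<Union>E))"

text \<open>The truncated subtractions only matter for \<open>n0 \<le> 1\<close>, where no diagonal is initial
  because there is no \<open>0\<close>-diagonal.\<close>

definition is_initial :: "nat \<Rightarrow> nat \<Rightarrow> (nat \<Rightarrow> real) set set \<Rightarrow> bool" where
  "is_initial d n0 D \<longleftrightarrow> is_diagonal d n0 D \<and>
     ((\<exists>E F. E \<noteq> F \<and> is_diagonal d (n0 - 1) E \<and> \<Union>E \<inter> \<Union>D \<noteq> {}
                  \<and> is_diagonal d (n0 - 1) F \<and> \<Union>F \<inter> \<Union>D \<noteq> {})
      \<or> ((\<exists>!E. is_diagonal d (n0 - 1) E \<and> \<Union>E \<inter> \<Union>D \<noteq> {}) \<and> \<Union>D \<inter> Cpow d (n0 - 2) = {}))"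

definition corner_case :: "nat \<Rightarrow> (nat \<Rightarrow> nat) \<Rightarrow> bool" where
  "corner_case d \<tau> \<longleftrightarrow> {1, 3} \<subseteq> \<tau> ` {1..d}"

definition central_case :: "nat \<Rightarrow> (nat \<Rightarrow> nat) \<Rightarrow> bool" where
  "central_case d \<tau> \<longleftrightarrow> (\<forall>i\<in>{1..d}. \<tau> i = 1)"

text \<open>Only the values \<open>\<tau> n i\<close> with \<open>n \<ge> n0\<close> and \<open>1 \<le> i \<le> d\<close> are relevant.\<close>

definition params :: "nat \<Rightarrow> (nat \<times> (nat \<Rightarrow> real) set set \<times> (nat \<Rightarrow> nat \<Rightarrow> nat)) set" where
  "params d = {(n0, D, \<tau>). n0 \<ge> 1 \<and> is_initial d n0 D
     \<and> (\<forall>n\<ge>n0. (\<forall>i\<in>{1..d}. \<tau> n i \<in> {1, 2, 3}) \<and> (corner_case d (\<tau> n) \<or> central_case d (\<tau> n)))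
     \<and> (\<forall>i\<in>{1..d}. infinite {n. n \<ge> n0 \<and> \<tau> n i \<in> {1, 2}})}"

text \<open>\<open>diag_seq d n0 D \<tau> n\<close> is the diagonal \<open>D_n\<close>, for \<open>n \<ge> n0\<close>; for \<open>n < n0\<close> it has the
  dummy value \<open>D\<close>.\<close>

primrec diag_seq ::
    "nat \<Rightarrow> nat \<Rightarrow> (nat \<Rightarrow> real) set set \<Rightarrow> (nat \<Rightarrow> nat \<Rightarrow> nat) \<Rightarrow> nat \<Rightarrow> (nat \<Rightarrow> real) set set" where
  "diag_seq d n0 D \<tau> 0 = D"
| "diag_seq d n0 D \<tau> (Suc n) =
     (if Suc n \<le> n0 then D else next_diagonal d n (diag_seq d n0 D \<tau> n) (\<tau> n))"

text \<open>
  \<open>is_sigma d n0 D \<tau> \<sigma>\<close> says that \<open>\<sigma>\<close> is the diagonal measure with parameters \<open>(n0, D, \<tau>)\<close>.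
  This is a predicate and not a definite description because for \<open>d \<ge> 3\<close> some
  degenerate members of \<open>params d\<close> have no such measure: if the central case occurs finitely often
  and \<open>\<tau> n i = 1\<close> for some fixed \<open>i\<close> and all large \<open>n\<close>, the measure would have to live on the
  orbit of one point whose \<open>i\<close>-th coordinate is in the forward orbit of \<open>0\<close>, and \<open>0\<close> has no
  preimage under \<open>T\<close>.
\<close>

definition is_sigma ::
    "nat \<Rightarrow> nat \<Rightarrow> (nat \<Rightarrow> real) set set \<Rightarrow> (nat \<Rightarrow> nat \<Rightarrow> nat) \<Rightarrow> (nat \<Rightarrow> real) measure \<Rightarrow> bool" where
  "is_sigma d n0 D \<tau> \<sigma> \<longleftrightarrow> diagonal_measure d \<sigma> \<and> n0_of d \<sigma> \<le> n0
     \<and> (\<forall>n\<ge>n0. D_of d \<sigma> n = diag_seq d n0 D \<tau> n)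
     \<and> emeasure \<sigma> (Cpow d n0) = 1"

end

theory Submission
  imports Defs
begin

text \<open>
  A point of \<open>X\<close> is described by its level in tower \<open>n\<close> for all large \<open>n\<close>, and passing from tower
  \<open>n\<close> to tower \<open>n + 1\<close> adds to the level index the starting index of the subcolumn that contains
  the point. So a box is a vector of indices, an \<open>n\<close>-diagonal is the set of all index vectors with
  prescribed differences between the coordinates (\<open>is_diagonal_diagonal_of\<close>, \<open>is_diagonalE\<close>), and
  \<open>D(\<tau>)\<close> is obtained by adding the starting indices (\<open>next_diagonal_eq\<close>). Everything then rests on
  three facts about a measure \<open>\<sigma>\<close> that lives on one diagonal \<open>D_n\<close> for every large \<open>n\<close>.

  Ergodicity. Invariance gives all boxes of \<open>D_n\<close> the same mass, and an invariant set \<open>A\<close> occupies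
  the same mass in each of them. A box of \<open>D_n\<close> is, up to a null set, a finite union of boxes of
  \<open>D_{n+1}\<close>, so the proportion of \<open>A\<close> in a box does not depend on \<open>n\<close> either. Boxes generate the
  \<open>\<sigma>\<close>-algebra; hence \<open>A\<close> occupies the same proportion of every set, in particular of its
  complement, and so \<open>A\<close> or its complement is null (theorem \<open>ergodic\<close> in the locale \<open>diagonal_sequence\<close>).

  Concentration. In the corner case, two coordinates of \<open>D_{n+1}\<close> have index difference close to
  the maximum \<open>2 * h_n + 1\<close> between subcolumns. This difference forces one to be in the first and the
  other in the third subcolumn as long as both are in tower \<open>n\<close>, and then it forces the subcolumns
  of all coordinates (\<open>corner_arith\<close>). So for almost every point the \<open>n\<close>th ternary digit
  of each coordinate is prescribed for infinitely many \<open>n\<close>, and a set of reals with infinitely many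
  prescribed digits is Lebesgue null (\<open>prescribed_digits_null\<close>). A graph joining has marginals
  proportional to \<open>\<mu>\<close> and cannot live on such a product of null sets (\<open>not_graph_joining\<close>).

  Conservativity. If \<open>W\<close> is wandering, its pieces in the boxes of \<open>D_n\<close>, pulled back to the first box,
  are disjoint there; so the mass of \<open>W\<close> in \<open>C_n^d\<close> is at most the mass of a single box
  (\<open>wandering_le_mass\<close>). Each central case at least halves the mass of a box (\<open>mass_central\<close>), so
  infinitely many of them leave no mass for \<open>W\<close>.

  For the existence of such a measure it is enough to let every step be a corner case: then the
  normalised counting measure on the two-sided orbit of one point is a diagonal measure. The point
  \<open>(1/4, 3/4, \<dots>, 3/4)\<close> works, as the ternary digits of \<open>1/4\<close> and \<open>3/4\<close> alternate between \<open>0\<close> and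
  \<open>2\<close> with opposite phases.
\<close>


section \<open>Levels and subcolumns\<close>

abbreviation half :: "nat \<Rightarrow> nat" where
  "half n \<equiv> height n div 2"

text \<open>The number of levels of tower \<open>n + 1\<close> below its \<open>k\<close>th subcolumn. The summand \<open>1\<close> is the spacer above
the middle subcolumn.\<close>

definition shift :: "nat \<Rightarrow> nat \<Rightarrow> nat" where
  "shift n k = (if k = 1 then 0 else if k = 2 then height n else 2 * height n + 1)"

lemma half_Suc: "half (Suc n) = 3 * height n + 1"
  by (simp add: height_Suc)

lemma height_ge1: "height n \<ge> 1"
  by (cases n) (auto simp: height_0 height_Suc)

lemma half_lt_height: "half n < height n"
  using height_ge1[of n] by auto

text \<open>The three subcolumns and the middle spacer are exactly the lower half of tower \<open>n + 1\<close>: the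
\<open>3 * h + 1\<close> spacers on top of the third subcolumn fill the upper half. This is why
all of tower \<open>n\<close> lies in \<open>C (n + 1)\<close>.\<close>

lemma shift_lt_half: "i < height n \<Longrightarrow> i + shift n k < half (Suc n)"
  by (auto simp: half_Suc shift_def)

lemma shift_lt_height: "i < height n \<Longrightarrow> i + shift n k < height (Suc n)"
  using shift_lt_half half_lt_height less_trans by blast

lemma tower_Suc: "tower (Suc n) = tower n
     @ (map (\<lambda>a. a + 1 / 3 ^ Suc n) (tower n) @ [real (height n) / 3 ^ n])
     @ (map (\<lambda>a. a + 2 * (1 / 3 ^ Suc n)) (tower n)
        @ map (\<lambda>k. real (height n) / 3 ^ n + real (Suc k) * (1 / 3 ^ Suc n)) [0..<3 * height n + 1])"
  by (simp only: tower.simps Let_def height_def)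

lemma tower_Suc_nth:
  assumes "i < height n" "k \<in> {1, 2, 3}"
  shows "tower (Suc n) ! (i + shift n k) = tower n ! i + (real k - 1) / 3 ^ Suc n"
  using assms unfolding tower_Suc shift_def
  by (auto simp: nth_append height_def[symmetric])

text \<open>The levels tile an initial interval by intervals of length \<open>1/3^n\<close>, so the left endpoints are an
enumeration of consecutive multiples of \<open>1/3^n\<close>. Disjointness of levels follows: a point determines
the left endpoint of its level by rounding down.\<close>

lemma set_tower: "set (tower n) = (\<lambda>k. real k / 3 ^ n) ` {..<height n}"
proof (induction n)
  case (Suc n)
  let ?q = "\<lambda>k. real k / 3 ^ Suc n" and ?h = "height n"
  have 0: "set (tower n) = ?q ` (\<lambda>k. 3 * k) ` {..<?h}"
    by (simp add: Suc image_image)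
  have 1: "(\<lambda>a. a + 1 / 3 ^ Suc n) ` set (tower n) = ?q ` (\<lambda>k. 3 * k + 1) ` {..<?h}"
    unfolding Suc image_image by (intro image_cong) (auto simp: field_simps)
  have 2: "(\<lambda>a. a + 2 * (1 / 3 ^ Suc n)) ` set (tower n) = ?q ` (\<lambda>k. 3 * k + 2) ` {..<?h}"
    unfolding Suc image_image by (intro image_cong) (auto simp: field_simps)
  have 3: "(\<lambda>k. real ?h / 3 ^ n + real (Suc k) * (1 / 3 ^ Suc n)) ` {0..<3 * ?h + 1}
      = ?q ` (\<lambda>k. 3 * ?h + Suc k) ` {..<3 * ?h + 1}"
    unfolding image_image by (intro image_cong) (auto simp: field_simps)
  have 4: "real ?h / 3 ^ n = ?q (3 * ?h)" by simp
  have "set (tower (Suc n)) = ?q ` ((\<lambda>k. 3 * k) ` {..<?h} \<union> (\<lambda>k. 3 * k + 1) ` {..<?h}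
      \<union> {3 * ?h} \<union> (\<lambda>k. 3 * k + 2) ` {..<?h} \<union> (\<lambda>k. 3 * ?h + Suc k) ` {..<3 * ?h + 1})"
    unfolding tower_Suc set_append set_map set_upt list.set 1 2 3 unfolding 0 4
    by (simp only: image_Un image_insert image_empty) blast
  also have "(\<lambda>k. 3 * k) ` {..<?h} \<union> (\<lambda>k. 3 * k + 1) ` {..<?h}
      \<union> {3 * ?h} \<union> (\<lambda>k. 3 * k + 2) ` {..<?h} \<union> (\<lambda>k. 3 * ?h + Suc k) ` {..<3 * ?h + 1}
      = {..<height (Suc n)}" (is "?L = ?R")
  proof
    show "?L \<subseteq> ?R" by (auto simp: height_Suc)
    show "?R \<subseteq> ?L"
    proof
      fix k assume k: "k \<in> ?R"
      show "k \<in> ?L"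
      proof (cases "k < 3 * ?h")
        case True
        then have "k div 3 < ?h" by auto
        moreover have "k = 3 * (k div 3) \<or> k = 3 * (k div 3) + 1 \<or> k = 3 * (k div 3) + 2" by presburger
        ultimately show ?thesis by (metis (no_types, lifting) UnI1 UnI2 imageI lessThan_iff)
      next
        case False
        show ?thesis
        proof (cases "k = 3 * ?h")
          case F: False
          have "k = 3 * ?h + Suc (k - 3 * ?h - 1)" "k - 3 * ?h - 1 < 3 * ?h + 1"
            using False F k by (auto simp: height_Suc)
          then have "k \<in> (\<lambda>k. 3 * ?h + Suc k) ` {..<3 * ?h + 1}" by blast
          then show ?thesis by blast
        qed auto
      qed
    qed
  qed
  finally show ?case .
qed (auto simp: height_def)

lemma distinct_tower: "distinct (tower n)"
proof -
  have "card (set (tower n)) = height n"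
    unfolding set_tower by (subst card_image) (auto simp: inj_on_def)
  then show ?thesis by (intro card_distinct) (simp add: height_def)
qed

lemma level_eq_index:
  assumes "x \<in> level n i" "x \<in> level n j" "i < height n" "j < height n"
  shows "i = j"
proof -
  have fl: "tower n ! m = real_of_int \<lfloor>x * 3 ^ n\<rfloor> / 3 ^ n" if m: "m < height n" "x \<in> level n m" for m
  proof -
    have "tower n ! m \<in> set (tower n)" using m(1) by (simp add: height_def)
    then obtain k where k: "tower n ! m = real k / 3 ^ n" unfolding set_tower by auto
    have "\<lfloor>x * 3 ^ n\<rfloor> = int k"
      using m(2) unfolding level_def k by (intro floor_unique) (auto simp: field_simps)
    then show ?thesis using k by simp
  qed
  show ?thesis
    using fl[OF assms(3,1)] fl[OF assms(4,2)] distinct_tower[of n] assms(3,4)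
    unfolding height_def by (metis nth_eq_iff_index_eq)
qed

lemma level_nonneg: "x \<in> level n i \<Longrightarrow> i < height n \<Longrightarrow> x \<ge> 0"
  using tower_occupies[of n] by auto

lemma level_Suc:
  assumes "i < height n" "k \<in> {1, 2, 3}"
  shows "level (Suc n) (i + shift n k)
    = {tower n ! i + (real k - 1) / 3 ^ Suc n ..< tower n ! i + real k / 3 ^ Suc n}"
  unfolding level_def tower_Suc_nth[OF assms] by (simp add: diff_divide_distrib)

lemma level_split:
  assumes "i < height n"
  shows "level n i = (\<Union>k\<in>{1, 2, 3}. level (Suc n) (i + shift n k))"
proof -
  define w :: real where "w = 1 / 3 ^ Suc n"
  have w: "w > 0" "1 / 3 ^ n = 3 * w" "\<And>r. r / 3 ^ Suc n = r * w" by (auto simp: w_def)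
  have "level (Suc n) (i + shift n k) = {tower n ! i + (real k - 1) * w ..< tower n ! i + real k * w}"
    if "k \<in> {1, 2, 3}" for k using level_Suc[OF assms that] unfolding w(3) .
  then have "(\<Union>k\<in>{1, 2, 3}. level (Suc n) (i + shift n k))
      = (\<Union>k\<in>{1, 2, 3}. {tower n ! i + (real k - 1) * w ..< tower n ! i + real k * w})"
    by (intro SUP_cong) auto
  also have "\<dots> = level n i" unfolding level_def w(2) using w(1) by auto
  finally show ?thesis by simp
qed

lemma level_splitE:
  assumes "x \<in> level n i" "i < height n"
  obtains k where "k \<in> {1, 2, 3}" "x \<in> level (Suc n) (i + shift n k)"
  using assms level_split by blast

lemma level_Suc_subset: "i < height n \<Longrightarrow> k \<in> {1, 2, 3} \<Longrightarrow> level (Suc n) (i + shift n k) \<subseteq> level n i"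
  using level_split by blast

lemma subcolumn_eq:
  assumes "k \<in> {1, 2, 3}"
  shows "subcolumn n k = (\<Union>i<height n. level (Suc n) (i + shift n k))"
  unfolding subcolumn_def by (intro SUP_cong) (simp_all only: level_Suc[OF _ assms] lessThan_iff)

lemma shift_inj:
  assumes "i + shift n k = i' + shift n k'" "i < height n" "i' < height n"
    "k \<in> {1, 2, 3}" "k' \<in> {1, 2, 3}"
  shows "k = k'"
  using assms by (auto simp: shift_def split: if_splits)

lemma t_eq:
  assumes "i < height n" "k \<in> {1, 2, 3}" "x \<in> level (Suc n) (i + shift n k)"
  shows "t n x = k"
  unfolding t_def
proof (rule the_equality)
  show "k \<in> {1, 2, 3} \<and> x \<in> subcolumn n k"
    unfolding subcolumn_eq[OF assms(2)] using assms by auto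
next
  fix k' assume k': "k' \<in> {1, 2, 3} \<and> x \<in> subcolumn n k'"
  then obtain i' where i': "i' < height n" "x \<in> level (Suc n) (i' + shift n k')"
    unfolding subcolumn_eq[OF conjunct1[OF k']] by auto
  have "i + shift n k = i' + shift n k'"
    using level_eq_index[OF assms(3) i'(2)] shift_lt_height assms(1) i'(1) by blast
  then show "k' = k" using shift_inj assms i'(1) k' by metis
qed

lemma level_subset_C: "i < height n \<Longrightarrow> level n i \<subseteq> C (Suc n)"
  unfolding level_split C_def using shift_lt_half by fastforce

lemma C_Suc_subset: "C n \<subseteq> C (Suc n)"
  using level_subset_C[of _ n] less_trans[OF _ half_lt_height[of n]] unfolding C_def[of n] by blast

lemma C_mono: "m \<le> n \<Longrightarrow> C m \<subseteq> C n"
  by (rule lift_Suc_mono_le[of C]) (use C_Suc_subset in auto)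

lemma C_exhausts:
  obtains n where "n \<ge> m" "{0..r} \<subseteq> C n"
proof -
  have two: "2 ^ n \<le> real (height n) / 3 ^ n" for n
    by (induction n) (auto simp: height_0 height_Suc field_simps)
  have ge: "real n \<le> real (height n) / 3 ^ n" for n
    by (rule order_trans[OF less_imp_le[OF of_nat_less_two_power] two])
  define n where "n = max m (Suc (nat \<lceil>r\<rceil>))"
  have "r < real n" unfolding n_def by linarith
  then have "{0..r} \<subseteq> {0..<real (height n) / 3 ^ n}" using ge[of n] by auto
  also have "\<dots> \<subseteq> C (Suc n)" unfolding tower_occupies[symmetric] using level_subset_C by blast
  finally show ?thesis using that[of "Suc n"] by (auto simp: n_def)
qed

lemma C_subset_interval: "C n \<subseteq> {0..<real (height n) / 3 ^ n}"
  unfolding C_def tower_occupies[symmetric] using half_lt_height[of n] by (intro UN_mono) auto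

lemma level_borel: "level n i \<in> sets borel"
  by (simp add: level_def)

lemma C_borel: "C n \<in> sets borel"
  unfolding C_def by (intro sets.finite_UN) (auto simp: level_borel)

section \<open>The transformation\<close>

text \<open>A level and the one above it are cut in the same way, so the displacement between them is inherited by
all later towers; this makes the union of the tower maps a function.\<close>

lemma T_consistent:
  assumes "x \<in> level n i" "Suc i < height n"
  shows "\<exists>j. Suc j < height (n + m) \<and> x \<in> level (n + m) j
    \<and> tower (n + m) ! Suc j - tower (n + m) ! j = tower n ! Suc i - tower n ! i"
proof (induction m)
  case (Suc m)
  then obtain j where j: "Suc j < height (n + m)" "x \<in> level (n + m) j"
    "tower (n + m) ! Suc j - tower (n + m) ! j = tower n ! Suc i - tower n ! i" by blast
  then obtain k where k: "k \<in> {1, 2, 3}" "x \<in> level (Suc (n + m)) (j + shift (n + m) k)"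
    using level_splitE by (metis Suc_lessD)
  show ?case
    using j k shift_lt_height[OF j(1), of k] tower_Suc_nth[OF j(1) k(1)] tower_Suc_nth[OF Suc_lessD[OF j(1)] k(1)]
    by (intro exI[of _ "j + shift (n + m) k"]) simp
qed (use assms in auto)

lemma T_eq:
  assumes "x \<in> level n i" "Suc i < height n"
  shows "T x = x - tower n ! i + tower n ! Suc i"
  unfolding T_def
proof (rule the_equality)
  fix y assume "\<exists>n i. Suc i < height n \<and> x \<in> level n i \<and> y = x - tower n ! i + tower n ! Suc i"
  then obtain n' i' where y: "Suc i' < height n'" "x \<in> level n' i'"
    "y = x - tower n' ! i' + tower n' ! Suc i'" by blast
  obtain j where j: "Suc j < height (n + n')" "x \<in> level (n + n') j"
    "tower (n + n') ! Suc j - tower (n + n') ! j = tower n ! Suc i - tower n ! i"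
    using T_consistent[OF assms] by blast
  obtain j' where j': "Suc j' < height (n + n')" "x \<in> level (n + n') j'"
    "tower (n + n') ! Suc j' - tower (n + n') ! j' = tower n' ! Suc i' - tower n' ! i'"
    using T_consistent[OF y(2,1), of n] by (metis add.commute)
  have "j = j'" using level_eq_index j j' Suc_lessD by blast
  then show "y = x - tower n ! i + tower n ! Suc i" using j(3) j'(3) y(3) by simp
qed (use assms in blast)

lemma T_level:
  assumes "x \<in> level n i" "Suc i < height n"
  shows "T x \<in> level n (Suc i)"
  using assms(1) unfolding T_eq[OF assms] by (auto simp: level_def)

lemma T_level_onto:
  assumes "y \<in> level n (Suc i)" "Suc i < height n"
  obtains x where "x \<in> level n i" "T x = y"
proof
  let ?x = "y - tower n ! Suc i + tower n ! i"
  show x: "?x \<in> level n i" using assms(1) by (auto simp: level_def)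
  show "T ?x = y" unfolding T_eq[OF x assms(2)] by simp
qed

text \<open>For \<open>n \<ge> 1\<close> the set \<open>C n\<close> avoids the top level, so statements about finitely many points can be
checked inside a single tower, where \<open>T\<close> moves every one of them up by one level.\<close>

lemma finite_subset_C:
  assumes "finite F" "F \<subseteq> {0..}"
  obtains n where "n \<ge> m" "n \<ge> 1" "F \<subseteq> C n"
proof -
  obtain n where "n \<ge> max m 1" "{0..Max (insert 0 F)} \<subseteq> C n" using C_exhausts .
  moreover have "F \<subseteq> {0..Max (insert 0 F)}" using assms by auto
  ultimately show ?thesis using that[of n] by auto
qed

lemma half_Suc_lt_height: "n \<ge> 1 \<Longrightarrow> i < half n \<Longrightarrow> Suc i < height n"
  by (cases n) (auto simp: height_Suc)

lemma T_inj:
  assumes "x \<ge> 0" "y \<ge> 0" "T x = T y"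
  shows "x = y"
proof -
  obtain n where n: "n \<ge> 1" "{x, y} \<subseteq> C n" using finite_subset_C[of "{x, y}" 0] assms by auto
  then obtain i j where ij: "i < half n" "x \<in> level n i" "j < half n" "y \<in> level n j"
    by (auto simp: C_def)
  have l: "Suc i < height n" "Suc j < height n" using half_Suc_lt_height n(1) ij by auto
  have "T x \<in> level n (Suc i)" "T x \<in> level n (Suc j)"
    using T_level[OF ij(2) l(1)] T_level[OF ij(4) l(2)] assms(3) by simp_all
  then have "i = j" using level_eq_index[OF _ _ l] by blast
  then have "T y = y - tower n ! i + tower n ! Suc i" using T_eq[OF ij(4) l(2)] by simp
  then show ?thesis using T_eq[OF ij(2) l(1)] assms(3) by linarith
qed

lemma T_nonneg:
  assumes "x \<ge> 0"
  shows "T x \<ge> 0"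
proof -
  obtain n where n: "n \<ge> 1" "{x} \<subseteq> C n" using finite_subset_C[of "{x}" 0] assms by auto
  then obtain i where "i < half n" "x \<in> level n i" by (auto simp: C_def)
  then show ?thesis using T_level level_nonneg half_Suc_lt_height n(1) by metis
qed

lemma T_level_iff:
  assumes "x \<ge> 0" "Suc i < height n"
  shows "T x \<in> level n (Suc i) \<longleftrightarrow> x \<in> level n i"
  by (metis T_inj T_level T_level_onto level_nonneg Suc_lessD assms)

text \<open>A positive point leaves the lowest level \<open>[0, 1/3^n)\<close> once \<open>n\<close> is large, and then it has a level below
it. Only \<open>0\<close> stays at the bottom of all towers.\<close>

lemma T_surj:
  assumes "y > 0"
  obtains x where "x \<ge> 0" "T x = y"
proof -
  obtain m where "(1 / 3) ^ m < y" using real_arch_pow_inv[of y "1 / 3"] assms by auto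
  then have m: "1 / 3 ^ m \<le> y" by (simp add: power_one_over)
  obtain n where n: "n \<ge> m" "{y} \<subseteq> C n" using finite_subset_C[of "{y}" m] assms by auto
  then obtain i where i: "i < half n" "y \<in> level n i" by (auto simp: C_def)
  have t0: "tower n ! 0 = 0" for n
  proof (induction n)
    case (Suc n)
    then show ?case using tower_Suc_nth[of 0 n 1] height_ge1[of n] by (simp add: shift_def)
  qed simp
  have "1 / 3 ^ n \<le> (1 :: real) / 3 ^ m" using n(1) by (simp add: divide_simps power_increasing)
  then have "i \<noteq> 0" using i(2) m t0[of n] by (auto simp: level_def intro: ccontr)
  then obtain i' where i': "i = Suc i'" using not0_implies_Suc by blast
  have "i < height n" using i(1) half_lt_height less_trans by blast
  then show ?thesis using T_level_onto[of y n i'] i(2) i' that level_nonneg[of _ n i'] by (metis Suc_lessD)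
qed

lemma T_pow_nonneg: "x \<ge> 0 \<Longrightarrow> (T ^^ k) x \<ge> 0"
  by (induction k) (auto intro: T_nonneg)

lemma T_pow_level_iff:
  assumes "x \<ge> 0" "i + k < height n"
  shows "(T ^^ k) x \<in> level n (i + k) \<longleftrightarrow> x \<in> level n i"
  using assms(2) by (induction k) (use assms(1) T_level_iff T_pow_nonneg in auto)

lemma space_mu: "space mu = {0..}" by (simp add: mu_def space_restrict_space)

lemma sets_mu: "A \<in> sets mu \<longleftrightarrow> A \<in> sets borel \<and> A \<subseteq> {0..}"
  by (auto simp: mu_def sets_restrict_space_iff)

lemma emeasure_mu: "A \<subseteq> {0..} \<Longrightarrow> emeasure mu A = emeasure lborel A"
  unfolding mu_def by (subst emeasure_restrict_space) auto

lemma level_sets_mu: "i < height n \<Longrightarrow> level n i \<in> sets mu"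
  using level_nonneg level_borel by (auto simp: sets_mu)

lemma T_measurable: "T \<in> measurable mu mu"
proof (rule measurableI)
  show "\<And>x. x \<in> space mu \<Longrightarrow> T x \<in> space mu" by (simp add: space_mu T_nonneg)
next
  fix A assume A: "A \<in> sets mu"
  have "T -` A \<inter> space mu = (\<Union>n. \<Union>i\<in>{i. Suc i < height n}.
      level n i \<inter> (\<lambda>x. x - tower n ! i + tower n ! Suc i) -` A)" (is "_ = ?R")
  proof (intro set_eqI iffI)
    fix x assume x: "x \<in> T -` A \<inter> space mu"
    then obtain n where n: "n \<ge> 1" "{x} \<subseteq> C n"
      using finite_subset_C[of "{x}" 0] by (auto simp: space_mu)
    then obtain i where i: "i < half n" "x \<in> level n i" by (auto simp: C_def)
    have "Suc i < height n" using half_Suc_lt_height n(1) i by auto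
    then show "x \<in> ?R" using x i T_eq by auto
  qed (use T_eq level_nonneg in \<open>auto simp: space_mu\<close>)
  also have "\<dots> \<in> sets borel"
  proof -
    have "level n i \<inter> (\<lambda>x. x - tower n ! i + tower n ! Suc i) -` A \<in> sets borel" for n i
    proof -
      have "(\<lambda>x. x - tower n ! i + tower n ! Suc i) -` A \<inter> space borel \<in> sets borel"
        using A by (intro measurable_sets[where A = borel]) (simp_all add: sets_mu)
      then show ?thesis using level_borel by auto
    qed
    then show ?thesis by (intro sets.countable_nat_UN image_subsetI sets.countable_UN') simp_all
  qed
  finally show "T -` A \<inter> space mu \<in> sets mu" unfolding sets_mu space_mu by blast
qed

section \<open>Boxes and diagonals\<close>

text \<open>Coordinates range over \<open>{1..d}\<close>. With \<open>i \<in> {1..d}\<close> kept as an atom, facts quantified over the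
coordinates apply directly.\<close>

declare atLeastAtMost_iff [simp del]

definition cell :: "nat \<Rightarrow> nat \<Rightarrow> (nat \<Rightarrow> nat) \<Rightarrow> (nat \<Rightarrow> real) set" where
  "cell d n j = PiE {1..d} (\<lambda>i. level n (j i))"

text \<open>The diagonal through the cell with index vector \<open>j\<close>. Any of its cells may serve as \<open>j\<close>, so the
offset \<open>k\<close> can be negative.\<close>

definition diagonal_of :: "nat \<Rightarrow> nat \<Rightarrow> (nat \<Rightarrow> nat) \<Rightarrow> (nat \<Rightarrow> real) set set" where
  "diagonal_of d n j = {cell d n j' | j'. (\<forall>i\<in>{1..d}. j' i < half n)
     \<and> (\<exists>k. \<forall>i\<in>{1..d}. int (j' i) = int (j i) + k)}"

lemma space_Xpow: "space (Xpow d) = PiE {1..d} (\<lambda>_. {0..})"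
  by (simp add: Xpow_def space_PiM space_mu)

lemma mem_space_Xpow: "x \<in> space (Xpow d) \<longleftrightarrow> x \<in> extensional {1..d} \<and> (\<forall>i\<in>{1..d}. x i \<ge> 0)"
  by (auto simp: space_Xpow PiE_iff)

lemma mem_cell: "x \<in> cell d n j \<longleftrightarrow> x \<in> extensional {1..d} \<and> (\<forall>i\<in>{1..d}. x i \<in> level n (j i))"
  by (auto simp: cell_def PiE_iff)

lemma is_box_iff: "is_box d n B \<longleftrightarrow> (\<exists>j. (\<forall>i\<in>{1..d}. j i < half n) \<and> B = cell d n j)"
  by (simp add: is_box_def cell_def)

lemma mem_Cpow: "x \<in> Cpow d n \<longleftrightarrow> (\<exists>j. (\<forall>i\<in>{1..d}. j i < half n) \<and> x \<in> cell d n j)"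
proof
  assume "x \<in> Cpow d n"
  then have "\<forall>i\<in>{1..d}. \<exists>q. q < half n \<and> x i \<in> level n q" and e: "x \<in> extensional {1..d}"
    by (auto simp: Cpow_def C_def PiE_iff)
  then obtain j where "\<forall>i\<in>{1..d}. j i < half n \<and> x i \<in> level n (j i)" by metis
  then show "\<exists>j. (\<forall>i\<in>{1..d}. j i < half n) \<and> x \<in> cell d n j" using e by (auto simp: mem_cell)
qed (auto simp: Cpow_def C_def PiE_iff mem_cell)

lemma CpowI: "x \<in> cell d n j \<Longrightarrow> \<forall>i\<in>{1..d}. j i < half n \<Longrightarrow> x \<in> Cpow d n"
  unfolding mem_Cpow by (intro exI[of _ j]) blast

lemma cell_cong: "(\<And>i. i \<in> {1..d} \<Longrightarrow> j i = j' i) \<Longrightarrow> cell d n j = cell d n j'"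
  unfolding cell_def by (intro PiE_cong) auto

lemma cell_subset_space: "\<forall>i\<in>{1..d}. j i < height n \<Longrightarrow> cell d n j \<subseteq> space (Xpow d)"
  unfolding mem_cell mem_space_Xpow subset_iff using level_nonneg by blast

lemma half_index: "\<forall>i\<in>I. j i < half n \<Longrightarrow> \<forall>i\<in>I. j i < height n"
  using half_lt_height less_trans by blast

lemma cell_pos_point:
  assumes "\<forall>i\<in>{1..d}. j i < height n"
  obtains x where "x \<in> cell d n j" "\<forall>i\<in>{1..d}. x i > 0"
proof
  let ?x = "\<lambda>i\<in>{1..d}. tower n ! j i + 1 / (2 * 3 ^ n)"
  show "?x \<in> cell d n j" by (auto simp: mem_cell level_def field_simps)
  have "tower n ! j i \<ge> 0" if "i \<in> {1..d}" for i
    using level_nonneg[of "tower n ! j i" n "j i"] assms that by (auto simp: level_def)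
  then show "\<forall>i\<in>{1..d}. ?x i > 0" by (auto intro!: add_nonneg_pos)
qed

lemma cell_index_unique:
  assumes "x \<in> cell d n j" "x \<in> cell d n j'" "\<forall>i\<in>{1..d}. j i < height n" "\<forall>i\<in>{1..d}. j' i < height n"
    "i \<in> {1..d}"
  shows "j i = j' i"
  using assms level_eq_index unfolding mem_cell by blast

lemma Tpow_pow: "x \<in> extensional {1..d} \<Longrightarrow> (Tpow d ^^ k) x = (\<lambda>i\<in>{1..d}. (T ^^ k) (x i))"
  by (induction k) (auto simp: Tpow_def extensional_restrict)

lemma Tpow_space: "x \<in> space (Xpow d) \<Longrightarrow> Tpow d x \<in> space (Xpow d)"
  by (auto simp: mem_space_Xpow Tpow_def T_nonneg)

lemma Tpow_cell_iff:
  assumes "x \<in> space (Xpow d)" "\<forall>i\<in>{1..d}. Suc (j i) < height n"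
  shows "Tpow d x \<in> cell d n (\<lambda>i. Suc (j i)) \<longleftrightarrow> x \<in> cell d n j"
  using assms T_level_iff by (auto simp: mem_cell mem_space_Xpow Tpow_def)

lemma Tpow_pow_cell_iff:
  assumes "x \<in> space (Xpow d)" "\<forall>i\<in>{1..d}. j i + k < height n"
  shows "(Tpow d ^^ k) x \<in> cell d n (\<lambda>i. j i + k) \<longleftrightarrow> x \<in> cell d n j"
  using assms T_pow_level_iff unfolding mem_space_Xpow by (auto simp: Tpow_pow mem_cell)

lemma Tpow_image_cell:
  assumes "\<forall>i\<in>{1..d}. Suc (j i) < height n"
  shows "Tpow d ` cell d n j = cell d n (\<lambda>i. Suc (j i))"
proof (intro set_eqI iffI)
  fix y assume "y \<in> Tpow d ` cell d n j"
  then show "y \<in> cell d n (\<lambda>i. Suc (j i))"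
    using assms T_level by (auto simp: mem_cell Tpow_def)
next
  fix y assume y: "y \<in> cell d n (\<lambda>i. Suc (j i))"
  have "\<forall>i\<in>{1..d}. \<exists>x. x \<in> level n (j i) \<and> T x = y i"
    using y assms T_level_onto unfolding mem_cell by metis
  then obtain x where x: "\<forall>i\<in>{1..d}. x i \<in> level n (j i) \<and> T (x i) = y i" by (rule bchoice[THEN exE]) blast
  have "y = Tpow d (restrict x {1..d})"
    using x y by (auto simp: Tpow_def mem_cell extensional_def fun_eq_iff)
  moreover have "restrict x {1..d} \<in> cell d n j" using x by (auto simp: mem_cell)
  ultimately show "y \<in> Tpow d ` cell d n j" by blast
qed

lemma Tpow_pow_image_cell:
  assumes "\<forall>i\<in>{1..d}. j i + k < height n"
  shows "(Tpow d ^^ k) ` cell d n j = cell d n (\<lambda>i. j i + k)"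
  using assms
proof (induction k)
  case (Suc k)
  then have "(Tpow d ^^ k) ` cell d n j = cell d n (\<lambda>i. j i + k)" by (metis Suc_lessD add_Suc_right)
  then have "(Tpow d ^^ Suc k) ` cell d n j = Tpow d ` cell d n (\<lambda>i. j i + k)"
    by (metis (no_types, lifting) funpow.simps(2) image_comp)
  also have "\<dots> = cell d n (\<lambda>i. j i + Suc k)" using Suc.prems by (subst Tpow_image_cell) auto
  finally show ?case .
qed simp

lemma mem_diagonal:
  assumes "x \<in> cell d n p" "\<forall>i\<in>{1..d}. p i < half n"
  shows "x \<in> \<Union>(diagonal_of d n j) \<longleftrightarrow> (\<exists>k. \<forall>i\<in>{1..d}. int (p i) = int (j i) + k)"
proof
  assume "x \<in> \<Union>(diagonal_of d n j)"
  then obtain j' k where "x \<in> cell d n j'" "\<forall>i\<in>{1..d}. j' i < half n"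
    "\<forall>i\<in>{1..d}. int (j' i) = int (j i) + k" by (auto simp: diagonal_of_def)
  moreover have "\<forall>i\<in>{1..d}. p i = j' i"
    using cell_index_unique[OF assms(1) calculation(1)] half_index assms(2) calculation(2) by blast
  ultimately show "\<exists>k. \<forall>i\<in>{1..d}. int (p i) = int (j i) + k" by auto
qed (use assms in \<open>auto simp: diagonal_of_def\<close>)

lemma diagonal_subset_Cpow: "\<Union>(diagonal_of d n j) \<subseteq> Cpow d n"
  using mem_Cpow by (auto simp: diagonal_of_def)

lemma diagonal_eq_if_meet:
  assumes "x \<in> \<Union>(diagonal_of d n j)" "x \<in> \<Union>(diagonal_of d n j')"
  shows "diagonal_of d n j = diagonal_of d n j'"
proof -
  obtain p where p: "\<forall>i\<in>{1..d}. p i < half n" "x \<in> cell d n p"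
    using assms(1) diagonal_subset_Cpow mem_Cpow by blast
  obtain k k' where "\<forall>i\<in>{1..d}. int (p i) = int (j i) + k" "\<forall>i\<in>{1..d}. int (p i) = int (j' i) + k'"
    using assms mem_diagonal[OF p(2,1)] by blast
  then have j: "\<forall>i\<in>{1..d}. int (j' i) = int (j i) + (k - k')" by auto
  have "(\<exists>m. \<forall>i\<in>{1..d}. int (q i) = int (j i) + m) \<longleftrightarrow> (\<exists>m. \<forall>i\<in>{1..d}. int (q i) = int (j' i) + m)"
    (is "?P \<longleftrightarrow> ?Q") for q
  proof
    assume ?P
    then obtain m where "\<forall>i\<in>{1..d}. int (q i) = int (j i) + m" by blast
    then show ?Q using j by (intro exI[of _ "m - (k - k')"]) auto
  next
    assume ?Q
    then obtain m where "\<forall>i\<in>{1..d}. int (q i) = int (j' i) + m" by blast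
    then show ?P using j by (intro exI[of _ "m + (k - k')"]) auto
  qed
  then show ?thesis by (simp add: diagonal_of_def)
qed

lemma add_lt_height: "n \<ge> 1 \<Longrightarrow> a + (k - 1) < half n \<Longrightarrow> a + k < height n"
  using half_Suc_lt_height[of n "a + (k - 1)"] half_lt_height[of n] by (cases k) auto

text \<open>Subtracting the least index \<open>m\<close> gives the first cell of the diagonal: one of its coordinates is
in the lowest level and has no preimage in the lower half of the tower. The diagonal ends when the
coordinate with the largest index \<open>M\<close> reaches the last level of the lower half.\<close>

lemma is_diagonal_diagonal_of:
  assumes d: "d \<ge> 1" and j: "\<forall>i\<in>{1..d}. j i < half n"
  shows "is_diagonal d n (diagonal_of d n j)"
proof -
  have I: "finite (j ` {1..d})" "j ` {1..d} \<noteq> {}" using d by auto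
  have n: "n \<ge> 1" using j d by (cases n) (auto simp: height_0)
  define m where "m = Min (j ` {1..d})"
  define M where "M = Max (j ` {1..d})"
  obtain a where a: "a \<in> {1..d}" "j a = m" using Min_in[OF I] unfolding m_def by force
  obtain b where b: "b \<in> {1..d}" "j b = M" using Max_in[OF I] unfolding M_def by force
  have bd: "m \<le> j i" "j i \<le> M" if "i \<in> {1..d}" for i
    using that I unfolding m_def M_def by auto
  define j0 where "j0 i = j i - m" for i
  define l where "l = half n - 1 - (M - m)"
  have M: "M < half n" using j b by auto
  have lt: "j0 i + k < half n" if "i \<in> {1..d}" "k \<le> l" for i k
    using bd[OF that(1)] that(2) M unfolding j0_def l_def by linarith
  have img: "(Tpow d ^^ k) ` cell d n j0 = cell d n (\<lambda>i. j0 i + k)" if "k \<le> Suc l" for k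
    using add_lt_height[OF n lt] that by (intro Tpow_pow_image_cell) auto
  show ?thesis
    unfolding is_diagonal_def
  proof (intro exI conjI)
    show "diagonal_of d n j = {(Tpow d ^^ k) ` cell d n j0 |k. k \<le> l}"
    proof (intro set_eqI iffI)
      fix B assume "B \<in> diagonal_of d n j"
      then obtain j' k where j': "B = cell d n j'" "\<forall>i\<in>{1..d}. j' i < half n"
        "\<forall>i\<in>{1..d}. int (j' i) = int (j i) + k" by (auto simp: diagonal_of_def)
      have "int (j' a) = int m + k" "int (j' b) = int M + k" "j' b < half n" using j' a b by auto
      moreover have "m \<le> M" using bd(1)[OF b(1)] b(2) by simp
      ultimately have k: "int (nat (k + int m)) = k + int m" "nat (k + int m) \<le> l"
        unfolding l_def by linarith+
      have "j' i = j0 i + nat (k + int m)" if "i \<in> {1..d}" for i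
        using j'(3)[rule_format, OF that] bd(1)[OF that] k(1) unfolding j0_def by linarith
      then have "B = (Tpow d ^^ nat (k + int m)) ` cell d n j0"
        unfolding j'(1) using img[of "nat (k + int m)"] k(2) cell_cong[of d j'] by simp
      then show "B \<in> {(Tpow d ^^ k) ` cell d n j0 |k. k \<le> l}" using k(2) by blast
    next
      fix B assume "B \<in> {(Tpow d ^^ k) ` cell d n j0 |k. k \<le> l}"
      then obtain k where k: "k \<le> l" "B = cell d n (\<lambda>i. j0 i + k)" using img by auto
      have "\<forall>i\<in>{1..d}. int (j0 i + k) = int (j i) + (int k - int m)"
      proof
        fix i assume "i \<in> {1..d}"
        then show "int (j0 i + k) = int (j i) + (int k - int m)"
          using bd(1)[of i] unfolding j0_def by linarith
      qed
      then show "B \<in> diagonal_of d n j" unfolding diagonal_of_def k(2) using lt[OF _ k(1)] by blast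
    qed
    show "\<forall>k\<le>l. is_box d n ((Tpow d ^^ k) ` cell d n j0)"
      using img lt unfolding is_box_iff by (metis le_SucI)
    show "\<not> Tpow d -` cell d n j0 \<inter> space (Xpow d) \<subseteq> Cpow d n"
    proof
      assume sub: "Tpow d -` cell d n j0 \<inter> space (Xpow d) \<subseteq> Cpow d n"
      have "\<forall>i\<in>{1..d}. j0 i < half n" using lt[of _ 0] by auto
      then have "\<forall>i\<in>{1..d}. j0 i < height n" by (rule half_index)
      then obtain y where y: "y \<in> cell d n j0" "\<forall>i\<in>{1..d}. y i > 0" using cell_pos_point by blast
      have "\<forall>i\<in>{1..d}. \<exists>x. x \<ge> 0 \<and> T x = y i" using T_surj y(2) by metis
      then obtain x where x: "\<forall>i\<in>{1..d}. x i \<ge> 0 \<and> T (x i) = y i" by (rule bchoice[THEN exE]) blast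
      have "Tpow d (restrict x {1..d}) = y"
        using x y by (auto simp: Tpow_def mem_cell extensional_def fun_eq_iff)
      moreover have "restrict x {1..d} \<in> space (Xpow d)" using x by (auto simp: mem_space_Xpow)
      ultimately have "restrict x {1..d} \<in> Cpow d n" using sub y(1) by auto
      then obtain q where q: "q < half n" "x a \<in> level n q" using a(1) by (auto simp: Cpow_def C_def PiE_iff)
      have "y a \<in> level n (Suc q)" using T_level[OF q(2)] half_Suc_lt_height[OF n q(1)] x a(1) by auto
      moreover have "y a \<in> level n 0" using y(1) a by (auto simp: mem_cell j0_def)
      ultimately show False
        using level_eq_index half_Suc_lt_height[OF n q(1)] height_ge1[of n] by (metis One_nat_def Suc_le_eq nat.distinct(1))
    qed
    show "\<not> (Tpow d ^^ (l + 1)) ` cell d n j0 \<subseteq> Cpow d n"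
    proof
      assume sub: "(Tpow d ^^ (l + 1)) ` cell d n j0 \<subseteq> Cpow d n"
      have lt': "\<forall>i\<in>{1..d}. j0 i + Suc l < height n" using lt[OF _ order_refl] half_Suc_lt_height[OF n] by auto
      from cell_pos_point[OF this] obtain y where y: "y \<in> cell d n (\<lambda>i. j0 i + Suc l)" by blast
      then have "y \<in> Cpow d n" using sub img[of "Suc l"] by auto
      then obtain q where q: "q < half n" "y b \<in> level n q" using b(1) by (auto simp: Cpow_def C_def PiE_iff)
      have "y b \<in> level n (j0 b + Suc l)" using y b(1) by (auto simp: mem_cell)
      then have "q = j0 b + Suc l"
        using level_eq_index q lt' b(1) half_lt_height less_trans by metis
      moreover have "j0 b + Suc l = half n"
        using M bd(1)[OF b(1)] unfolding j0_def l_def b(2) by linarith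
      ultimately show False using q(1) by simp
    qed
  qed
qed

text \<open>Maximality of the family excludes every further cell with the same index differences: a
smaller offset would put the preimage of the first cell into \<open>C_n^d\<close>, a larger one the image of the
last cell.\<close>

lemma is_diagonalE:
  assumes d: "d \<ge> 1" and D: "is_diagonal d n D"
  obtains j where "\<forall>i\<in>{1..d}. j i < half n" "D = diagonal_of d n j"
proof -
  from D obtain B l where Bl: "D = {(Tpow d ^^ k) ` B | k. k \<le> l}"
    "\<forall>k\<le>l. is_box d n ((Tpow d ^^ k) ` B)" "\<not> (Tpow d -` B \<inter> space (Xpow d) \<subseteq> Cpow d n)"
    "\<not> ((Tpow d ^^ (l + 1)) ` B \<subseteq> Cpow d n)" unfolding is_diagonal_def by blast
  from Bl(2)[rule_format, of 0] obtain j where j: "\<forall>i\<in>{1..d}. j i < half n" "B = cell d n j"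
    unfolding is_box_iff by auto
  have n: "n \<ge> 1" using j d by (cases n) (auto simp: height_0)
  have step: "(Tpow d ^^ k) ` B = cell d n (\<lambda>i. j i + k)" if "\<forall>i\<in>{1..d}. j i + (k - 1) < half n" for k
    unfolding j(2) using add_lt_height[OF n] that by (intro Tpow_pow_image_cell) blast
  have lt: "\<forall>i\<in>{1..d}. j i + k < half n" if "k \<le> l" for k
    using that
  proof (induction k)
    case (Suc k)
    then have e: "(Tpow d ^^ Suc k) ` B = cell d n (\<lambda>i. j i + Suc k)" by (intro step) auto
    then obtain j' where j': "\<forall>i\<in>{1..d}. j' i < half n" "cell d n (\<lambda>i. j i + Suc k) = cell d n j'"
      using Bl(2) Suc.prems unfolding is_box_iff by metis
    have h: "\<forall>i\<in>{1..d}. j i + Suc k < height n" using Suc half_Suc_lt_height[OF n] by auto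
    obtain x where x: "x \<in> cell d n (\<lambda>i. j i + Suc k)" using cell_pos_point[OF h] by blast
    have "j i + Suc k = j' i" if "i \<in> {1..d}" for i
      using cell_index_unique[OF x _ h half_index[OF j'(1)] that] x j'(2) by simp
    then show ?case using j'(1) by auto
  qed (use j in auto)
  have "D = diagonal_of d n j"
  proof (intro set_eqI iffI)
    fix E assume "E \<in> D"
    then obtain k where k: "k \<le> l" "E = (Tpow d ^^ k) ` B" unfolding Bl(1) by blast
    have "\<forall>i\<in>{1..d}. j i + (k - 1) < half n" using lt[of "k - 1"] k(1) by auto
    from step[OF this] have "E = cell d n (\<lambda>i. j i + k)" using k(2) by simp
    then show "E \<in> diagonal_of d n j" using lt[OF k(1)] unfolding diagonal_of_def
      by (auto intro!: exI[of _ "\<lambda>i. j i + k"] exI[of _ "int k"])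
  next
    fix E assume "E \<in> diagonal_of d n j"
    then obtain j' k where j': "E = cell d n j'" "\<forall>i\<in>{1..d}. j' i < half n"
        "\<forall>i\<in>{1..d}. int (j' i) = int (j i) + k" by (auto simp: diagonal_of_def)
    have "k \<ge> 0"
    proof (rule ccontr)
      assume "\<not> k \<ge> 0"
      then have pos: "\<forall>i\<in>{1..d}. j i \<ge> 1" using j'(3) by fastforce
      have "Tpow d -` B \<inter> space (Xpow d) \<subseteq> Cpow d n"
      proof
        fix x assume x: "x \<in> Tpow d -` B \<inter> space (Xpow d)"
        have "cell d n (\<lambda>i. Suc (j i - 1)) = B" unfolding j(2) by (intro cell_cong) (use pos in fastforce)
        then have "x \<in> cell d n (\<lambda>i. j i - 1)"
          using x Tpow_cell_iff[of x d "\<lambda>i. j i - 1" n] pos half_index[OF j(1)] by fastforce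
        moreover have "\<forall>i\<in>{1..d}. j i - 1 < half n" using j(1) by auto
        ultimately show "x \<in> Cpow d n" by (rule CpowI)
      qed
      then show False using Bl(3) by blast
    qed
    moreover have "k \<le> int l"
    proof (rule ccontr)
      assume k: "\<not> k \<le> int l"
      have s: "j i + (l + 1) < half n" if "i \<in> {1..d}" for i
        using k j'(2,3) that by fastforce
      have "(Tpow d ^^ (l + 1)) ` B = cell d n (\<lambda>i. j i + (l + 1))" using lt[OF order_refl] by (intro step) simp
      also have "\<dots> \<subseteq> Cpow d n"
      proof
        fix x assume "x \<in> cell d n (\<lambda>i. j i + (l + 1))"
        then show "x \<in> Cpow d n" by (rule CpowI) (use s in blast)
      qed
      finally show False using Bl(4) by blast
    qed
    ultimately have k: "int (nat k) = k" "nat k \<le> l" by auto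
    have "j' i = j i + nat k" if "i \<in> {1..d}" for i
      using j'(3)[rule_format, OF that] k(1) by linarith
    then have "E = cell d n (\<lambda>i. j i + nat k)" unfolding j'(1) by (rule cell_cong)
    moreover have "\<forall>i\<in>{1..d}. j i + (nat k - 1) < half n" using lt[of "nat k - 1"] k(2) by auto
    ultimately have "E = (Tpow d ^^ nat k) ` B" using step by simp
    then show "E \<in> D" unfolding Bl(1) using k(2) by blast
  qed
  then show ?thesis using that j(1) by blast
qed

lemma subbox_cell:
  assumes "\<forall>i\<in>{1..d}. j i < height n" "\<forall>i\<in>{1..d}. \<tau> i \<in> {1, 2, 3}"
  shows "subbox d n (cell d n j) \<tau> = cell d (Suc n) (\<lambda>i. j i + shift n (\<tau> i))"
proof -
  have "x \<in> level n (j i) \<and> t n x = \<tau> i \<longleftrightarrow> x \<in> level (Suc n) (j i + shift n (\<tau> i))"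
    if "i \<in> {1..d}" for x i
  proof -
    have a: "j i < height n" "\<tau> i \<in> {1, 2, 3}" using assms that by auto
    show ?thesis using t_eq[OF a(1)] a level_Suc_subset level_splitE by (metis subsetD)
  qed
  then show ?thesis unfolding subbox_def set_eq_iff mem_cell mem_Collect_eq by blast
qed

lemma next_diagonal_eq:
  assumes d: "d \<ge> 1" and j: "\<forall>i\<in>{1..d}. j i < half n" and \<tau>: "\<forall>i\<in>{1..d}. \<tau> i \<in> {1, 2, 3}"
  shows "next_diagonal d n (diagonal_of d n j) \<tau> = diagonal_of d (Suc n) (\<lambda>i. j i + shift n (\<tau> i))"
    (is "_ = ?E")
  unfolding next_diagonal_def
proof (rule the_equality)
  have lt: "j' i + shift n (\<tau> i) < half (Suc n)" if "i \<in> {1..d}" "\<forall>i\<in>{1..d}. j' i < half n" for i j'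
    using that half_index shift_lt_half by blast
  have "subbox d n B \<tau> \<subseteq> \<Union>?E" if "B \<in> diagonal_of d n j" for B
  proof -
    from that obtain j' k where j': "B = cell d n j'" "\<forall>i\<in>{1..d}. j' i < half n"
        "\<forall>i\<in>{1..d}. int (j' i) = int (j i) + k" by (auto simp: diagonal_of_def)
    have "cell d (Suc n) (\<lambda>i. j' i + shift n (\<tau> i)) \<in> ?E"
      unfolding diagonal_of_def using j' lt
      by (auto intro!: exI[of _ "\<lambda>i. j' i + shift n (\<tau> i)"] exI[of _ k])
    then show ?thesis unfolding j'(1) subbox_cell[OF half_index[OF j'(2)] \<tau>] by blast
  qed
  moreover have "is_diagonal d (Suc n) ?E" using lt j by (intro is_diagonal_diagonal_of d) auto
  ultimately show "is_diagonal d (Suc n) ?E \<and> (\<forall>B\<in>diagonal_of d n j. subbox d n B \<tau> \<subseteq> \<Union>?E)" by blast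
  fix E assume E: "is_diagonal d (Suc n) E \<and> (\<forall>B\<in>diagonal_of d n j. subbox d n B \<tau> \<subseteq> \<Union>E)"
  obtain e where e: "E = diagonal_of d (Suc n) e" by (rule is_diagonalE[OF d conjunct1[OF E]])
  have b: "cell d n j \<in> diagonal_of d n j" using j by (auto simp: diagonal_of_def)
  have "\<forall>i\<in>{1..d}. j i + shift n (\<tau> i) < height (Suc n)" using j half_index shift_lt_height by blast
  from cell_pos_point[OF this] obtain x where x: "x \<in> cell d (Suc n) (\<lambda>i. j i + shift n (\<tau> i))" by blast
  have "x \<in> subbox d n (cell d n j) \<tau>" using x unfolding subbox_cell[OF half_index[OF j] \<tau>] .
  then have "x \<in> \<Union>E" using E b by blast
  moreover have "x \<in> \<Union>?E" using lt[OF _ j] by (subst mem_diagonal[OF x]) (auto intro!: exI[of _ 0])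
  ultimately show "E = ?E" using diagonal_eq_if_meet unfolding e by blast
qed

text \<open>Two indices below \<open>h/2\<close> differ by less than \<open>h/2\<close>, while starting indices of different subcolumns differ
by at least \<open>h\<close>. The differences of starting indices are \<open>0\<close>, \<open>h\<close>, \<open>h + 1\<close> and \<open>2 * h + 1\<close> up to sign,
so an index difference within \<open>h/2\<close> of \<open>2 * h + 1\<close> comes only from the pair of the first and the
third subcolumn. This fixes the digit of the coordinate \<open>a\<close>; as it is then the same on both sides, \<open>k\<close> is less than \<open>h/2\<close> in absolute value, which is too small to move any
other coordinate to a different subcolumn.\<close>

lemma corner_arith:
  assumes corner: "corner_case d \<tau>"
    and pq: "\<forall>i\<in>{1..d}. p i < half n \<and> q i < half n"
    and \<tau>: "\<forall>i\<in>{1..d}. \<tau> i \<in> {1, 2, 3} \<and> \<tau>' i \<in> {1, 2, 3}"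
    and off: "\<forall>i\<in>{1..d}. int (q i + shift n (\<tau>' i)) = int (p i + shift n (\<tau> i)) + k"
    and i: "i \<in> {1..d}"
  shows "\<tau>' i = \<tau> i \<and> int (q i) = int (p i) + k"
proof -
  obtain a b where ab: "a \<in> {1..d}" "\<tau> a = 1" "b \<in> {1..d}" "\<tau> b = 3"
    using corner unfolding corner_case_def by (metis imageE insert_subset)
  have h: "2 * p i < height n" "2 * q i < height n" if "i \<in> {1..d}" for i
    using pq[rule_format, OF that] by linarith+
  have "\<tau>' a = 1"
    using off[rule_format, OF ab(1)] off[rule_format, OF ab(3)] \<tau> h[OF ab(1)] h[OF ab(3)] ab
    unfolding shift_def by (auto split: if_splits)
  then have "int (q a) = int (p a) + k" using off[rule_format, OF ab(1)] ab unfolding shift_def by auto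
  then show ?thesis
    using off[rule_format, OF i] \<tau> h[OF i] h[OF ab(1)] i
    unfolding shift_def by (auto split: if_splits)
qed

text \<open>In the corner case, a point of \<open>C_n^d\<close> on the diagonal \<open>D(\<tau>)\<close> is in a cell \<open>B(\<tau>)\<close> of a box \<open>B\<close> of
\<open>D\<close>: no other copy of a box is met. The offset \<open>k\<close> along the diagonal is preserved, so
the conclusion can be iterated down to smaller \<open>n\<close>.\<close>

lemma corner_descend:
  assumes corner: "corner_case d \<tau>" and J: "\<forall>i\<in>{1..d}. J i < half n"
    and \<tau>: "\<forall>i\<in>{1..d}. \<tau> i \<in> {1, 2, 3}"
    and x: "x \<in> Cpow d n" "x \<in> cell d (Suc n) q"
    and q: "\<forall>i\<in>{1..d}. q i < half (Suc n)" "\<forall>i\<in>{1..d}. int (q i) = int (J i + shift n (\<tau> i)) + k"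
  obtains p where "x \<in> cell d n p" "\<forall>i\<in>{1..d}. p i < half n" "\<forall>i\<in>{1..d}. int (p i) = int (J i) + k"
    "\<forall>i\<in>{1..d}. x i \<in> subcolumn n (\<tau> i)"
proof -
  obtain p where p: "\<forall>i\<in>{1..d}. p i < half n" "x \<in> cell d n p" using x(1) mem_Cpow by blast
  have "\<forall>i\<in>{1..d}. \<exists>k. k \<in> {1, 2, 3} \<and> x i \<in> level (Suc n) (p i + shift n k)"
    using p half_index level_splitE unfolding mem_cell by metis
  then obtain \<theta> where \<theta>: "\<forall>i\<in>{1..d}. \<theta> i \<in> {1, 2, 3} \<and> x i \<in> level (Suc n) (p i + shift n (\<theta> i))"
    by (rule bchoice[THEN exE]) blast
  have xb: "x \<in> cell d (Suc n) (\<lambda>i. p i + shift n (\<theta> i))" using p(2) \<theta> by (auto simp: mem_cell)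
  have "\<forall>i\<in>{1..d}. p i + shift n (\<theta> i) < half (Suc n)" using p(1) half_index shift_lt_half by blast
  then have "p i + shift n (\<theta> i) = q i" if "i \<in> {1..d}" for i
    using cell_index_unique[OF xb x(2) half_index half_index[OF q(1)] that] by blast
  then have k: "\<forall>i\<in>{1..d}. int (p i + shift n (\<theta> i)) = int (J i + shift n (\<tau> i)) + k"
    using q(2) by simp
  have c: "\<theta> i = \<tau> i \<and> int (p i) = int (J i) + k" if "i \<in> {1..d}" for i
    using corner_arith[OF corner _ _ k that] J p(1) \<tau> \<theta> by blast
  have "\<forall>i\<in>{1..d}. x i \<in> subcolumn n (\<tau> i)"
  proof
    fix i assume i: "i \<in> {1..d}"
    have "x i \<in> level (Suc n) (p i + shift n (\<tau> i))" "p i < height n"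
      using c[OF i] \<theta> i p(1) half_index by auto
    then show "x i \<in> subcolumn n (\<tau> i)" using \<tau> i by (subst subcolumn_eq) auto
  qed
  then show ?thesis using that p c by blast
qed

section \<open>Cells as a generator\<close>

lemma level_nested:
  assumes "x \<in> level n i" "i < height n" "x \<in> level (n + m) j" "j < height (n + m)"
  shows "level (n + m) j \<subseteq> level n i"
  using assms(3,4)
proof (induction m arbitrary: j)
  case 0
  then show ?case using level_eq_index[OF assms(1) _ assms(2), of j] by auto
next
  case (Suc m)
  have "x \<in> (\<Union>i<height (n + m). level (n + m) i)"
  proof -
    have "x \<in> (\<Union>i<height n. level n i)" using assms(1,2) by blast
    moreover have "(\<Union>i<height n. level n i) \<subseteq> (\<Union>i<height (n + m). level (n + m) i)"
    proof (rule lift_Suc_mono_le[where f = "\<lambda>n. \<Union>i<height n. level n i"])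
      show "(\<Union>i<height n. level n i) \<subseteq> (\<Union>i<height (Suc n). level (Suc n) i)" for n
        using level_subset_C[of _ n] half_lt_height[of "Suc n"] unfolding C_def by fastforce
    qed simp
    ultimately show ?thesis by blast
  qed
  then obtain l where l: "l < height (n + m)" "x \<in> level (n + m) l" by blast
  then obtain k where k: "k \<in> {1, 2, 3}" "x \<in> level (Suc (n + m)) (l + shift (n + m) k)"
    using level_splitE by metis
  have "j = l + shift (n + m) k"
    using level_eq_index[of x "Suc (n + m)"] Suc.prems k(2) shift_lt_height[OF l(1)] by simp
  then have "level (n + Suc m) j \<subseteq> level (n + m) l" using level_Suc_subset[OF l(1) k(1)] by simp
  then show ?case using Suc.IH[OF l(2,1)] by blast
qed

lemma cell_nested:
  assumes "x \<in> cell d n j" "\<forall>i\<in>{1..d}. j i < height n"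
    "x \<in> cell d m j'" "\<forall>i\<in>{1..d}. j' i < height m" "n \<le> m"
  shows "cell d m j' \<subseteq> cell d n j"
proof -
  have "level m (j' i) \<subseteq> level n (j i)" if "i \<in> {1..d}" for i
    using level_nested[of "x i" n "j i" "m - n" "j' i"] assms that by (simp add: mem_cell)
  then show ?thesis unfolding mem_cell subset_iff by blast
qed

definition cells :: "nat \<Rightarrow> nat \<Rightarrow> (nat \<Rightarrow> real) set set" where
  "cells d n = {cell d n j | j. \<forall>i\<in>{1..d}. j i < half n}"

lemma finite_cells: "finite (cells d n)"
proof -
  have "cells d n \<subseteq> cell d n ` PiE {1..d} (\<lambda>_. {..<half n})"
  proof
    fix B assume "B \<in> cells d n"
    then obtain j where j: "B = cell d n j" "\<forall>i\<in>{1..d}. j i < half n" by (auto simp: cells_def)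
    have "B = cell d n (restrict j {1..d})" unfolding j(1) by (intro cell_cong) simp
    then show "B \<in> cell d n ` PiE {1..d} (\<lambda>_. {..<half n})" using j(2) by (auto simp: PiE_iff)
  qed
  moreover have "finite (PiE {1..d} (\<lambda>_. {..<half n}))" by (intro finite_PiE) auto
  ultimately show ?thesis by (meson finite_imageI finite_subset)
qed

lemma cells_disjoint:
  assumes "B \<in> cells d n" "B' \<in> cells d n" "x \<in> B" "x \<in> B'"
  shows "B = B'"
proof -
  obtain j j' where j: "B = cell d n j" "\<forall>i\<in>{1..d}. j i < half n"
      "B' = cell d n j'" "\<forall>i\<in>{1..d}. j' i < half n" using assms(1,2) unfolding cells_def by blast
  show ?thesis
    using cell_nested[of x d n j n j'] cell_nested[of x d n j' n j] assms(3,4)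
      half_index[OF j(2)] half_index[OF j(4)] unfolding j(1,3) by blast
qed

lemma diagonal_subset_cells: "diagonal_of d n j \<subseteq> cells d n"
  by (auto simp: diagonal_of_def cells_def)

lemma Union_cells: "\<Union>(cells d n) = Cpow d n"
  unfolding cells_def set_eq_iff mem_Cpow by blast

lemma Cpow_mono: "n \<le> m \<Longrightarrow> Cpow d n \<subseteq> Cpow d m"
  unfolding Cpow_def using C_mono by (intro PiE_mono) auto

lemma Cpow_exhausts:
  assumes "x \<in> space (Xpow d)"
  obtains n where "n \<ge> m" "n \<ge> 1" "x \<in> Cpow d n"
proof -
  obtain n where "n \<ge> m" "n \<ge> 1" "x ` {1..d} \<subseteq> C n"
    using finite_subset_C[of "x ` {1..d}" m] assms by (auto simp: mem_space_Xpow)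
  then show ?thesis using that assms unfolding Cpow_def PiE_iff mem_space_Xpow by blast
qed

lemma cell_sets: "\<forall>i\<in>{1..d}. j i < height n \<Longrightarrow> cell d n j \<in> sets (Xpow d)"
  unfolding cell_def Xpow_def by (intro sets_PiM_I_finite) (auto intro: level_sets_mu)

lemma cells_sets: "B \<in> cells d n \<Longrightarrow> B \<in> sets (Xpow d)"
  unfolding cells_def using cell_sets half_index by blast

lemma diagonal_sets: "\<Union>(diagonal_of d n j) \<in> sets (Xpow d)"
  using finite_subset[OF diagonal_subset_cells finite_cells] diagonal_subset_cells cells_sets
  by (intro sets.finite_Union) blast+

lemma Cpow_sets: "Cpow d n \<in> sets (Xpow d)"
  unfolding Union_cells[symmetric] using cells_sets by (intro sets.finite_Union finite_cells) auto

lemma Cpow_finite: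
  assumes "boundedly_finite d \<sigma>"
  shows "emeasure \<sigma> (Cpow d n) < \<infinity>"
proof -
  have "\<exists>r. \<forall>x\<in>Cpow d n. \<forall>i\<in>{1..d}. x i \<le> r"
    using C_subset_interval[of n]
    by (intro exI[of _ "real (height n) / 3 ^ n"]) (force simp: Cpow_def PiE_iff)
  then show ?thesis using assms Cpow_sets unfolding boundedly_finite_def by blast
qed

definition generator :: "nat \<Rightarrow> nat \<Rightarrow> (nat \<Rightarrow> real) set set" where
  "generator d N = insert {} (\<Union>n\<in>{N..}. cells d n)"

lemma generator_sets: "B \<in> generator d N \<Longrightarrow> B \<in> sets (Xpow d)"
  using cells_sets by (auto simp: generator_def)

lemma countable_generator: "countable (generator d N)"
  unfolding generator_def 
  by (intro countable_insert countable_UN countable_finite[OF finite_cells]) auto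

lemma Int_stable_generator: "Int_stable (generator d N)"
proof -
  have *: "B \<inter> B' \<in> generator d N"
    if B: "B \<in> cells d n" "B' \<in> cells d m" "N \<le> m" "n \<le> m" for n m B B'
  proof (cases "B \<inter> B' = {}")
    case False
    then obtain x where x: "x \<in> B" "x \<in> B'" by blast
    obtain j j' where j: "B = cell d n j" "\<forall>i\<in>{1..d}. j i < half n"
      "B' = cell d m j'" "\<forall>i\<in>{1..d}. j' i < half m" using B(1,2) unfolding cells_def by blast
    have "B' \<subseteq> B"
      using cell_nested[of x d n j m j'] x half_index[OF j(2)] half_index[OF j(4)] B(4)
      unfolding j(1,3) by blast
    then have "B \<inter> B' = B'" by blast
    then show ?thesis using B by (auto simp: generator_def)
  qed (simp add: generator_def)
  show ?thesis
    unfolding Int_stable_def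
  proof (intro ballI)
    fix B B' assume BB: "B \<in> generator d N" "B' \<in> generator d N"
    show "B \<inter> B' \<in> generator d N"
    proof (cases "B = {} \<or> B' = {}")
      case False
      then obtain n m where nm: "n \<ge> N" "B \<in> cells d n" "m \<ge> N" "B' \<in> cells d m"
        using BB by (auto simp: generator_def)
      then show ?thesis using *[of B n B' m] *[of B' m B n] by (cases "n \<le> m") (auto simp: Int_commute)
    qed (auto simp: generator_def)
  qed
qed

lemma small_cell:
  assumes "x \<in> space (Xpow d)" "x i < a" "i \<in> {1..d}"
  obtains B where "B \<in> generator d N" "x \<in> B" "B \<subseteq> {y. y i < a}"
proof -
  obtain m where "(1 / 3) ^ m < a - x i" using real_arch_pow_inv[of "a - x i" "1 / 3"] assms(2) by auto
  then have m: "1 / 3 ^ m < a - x i" by (simp add: power_one_over)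
  obtain n where n: "n \<ge> max m N" "x \<in> Cpow d n" using Cpow_exhausts[OF assms(1)] by blast
  then obtain j where j: "\<forall>i\<in>{1..d}. j i < half n" "x \<in> cell d n j" unfolding mem_Cpow by blast
  have "1 / 3 ^ n \<le> (1 :: real) / 3 ^ m" using n(1) by (simp add: divide_simps power_increasing)
  moreover have "y i < x i + 1 / 3 ^ n" if "y \<in> cell d n j" for y
  proof -
    have "x i \<in> level n (j i)" "y i \<in> level n (j i)" using that j(2) assms(3) by (auto simp: mem_cell)
    then show ?thesis by (auto simp: level_def)
  qed
  ultimately have "cell d n j \<subseteq> {y. y i < a}" using m by force
  moreover have "cell d n j \<in> generator d N" using j(1) n(1) by (auto simp: generator_def cells_def)
  ultimately show ?thesis using that j(2) by blast
qed

text \<open>The sides of the cells shrink to \<open>0\<close>, so every half-space \<open>x i < a\<close> is a countable union of cells.\<close>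

lemma sets_Xpow_generator: "sets (Xpow d) = sigma_sets (space (Xpow d)) (generator d N)"
proof
  let ?\<Sigma> = "sigma (space (Xpow d)) (generator d N)"
  have sub: "generator d N \<subseteq> Pow (space (Xpow d))" using generator_sets sets.sets_into_space by blast
  then have s: "space ?\<Sigma> = space (Xpow d)" "sets ?\<Sigma> = sigma_sets (space (Xpow d)) (generator d N)"
    by (simp_all add: space_measure_of_conv)
  show "sigma_sets (space (Xpow d)) (generator d N) \<subseteq> sets (Xpow d)"
    using generator_sets by (intro sets.sigma_sets_subset) auto
  have coord: "(\<lambda>x. x i) \<in> measurable ?\<Sigma> mu" if i: "i \<in> {1..d}" for i
    unfolding mu_def
  proof (rule measurable_restrict_space2)
    show "(\<lambda>x. x i) \<in> space ?\<Sigma> \<rightarrow> {0..}" using i unfolding s(1) mem_space_Xpow by (auto simp: mem_space_Xpow)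
    have "{x \<in> space ?\<Sigma>. x i < a} \<in> sets ?\<Sigma>" for a
    proof -
      have "{x \<in> space ?\<Sigma>. x i < a} = \<Union>{B \<in> generator d N. B \<subseteq> {y. y i < a}}"
        unfolding s(1)
      proof (intro set_eqI iffI)
        fix x assume "x \<in> {x \<in> space (Xpow d). x i < a}"
        then obtain B where "B \<in> generator d N" "x \<in> B" "B \<subseteq> {y. y i < a}"
          using small_cell[of x d i a N] i by auto
        then show "x \<in> \<Union>{B \<in> generator d N. B \<subseteq> {y. y i < a}}" by auto
      next
        fix x assume "x \<in> \<Union>{B \<in> generator d N. B \<subseteq> {y. y i < a}}"
        then show "x \<in> {x \<in> space (Xpow d). x i < a}" using sub by auto
      qed
      moreover have "\<dots> \<in> sets ?\<Sigma>"
        using countable_generator[of d N] sub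
        by (intro sets.countable_Union) (auto intro: countable_subset)
      ultimately show ?thesis by simp
    qed
    then have "(\<lambda>x. x i) \<in> borel_measurable ?\<Sigma>" unfolding borel_measurable_iff_less by blast
    then show "(\<lambda>x. x i) \<in> measurable ?\<Sigma> lborel" by simp
  qed
  have "(\<lambda>x i. x i) \<in> measurable ?\<Sigma> (PiM {1..d} (\<lambda>_. mu))"
  proof (rule measurable_PiM_single')
    show "(\<lambda>x i. x i) \<in> space ?\<Sigma> \<rightarrow> (\<Pi>\<^sub>E i\<in>{1..d}. space mu)"
      unfolding s(1) unfolding space_Xpow space_mu by (rule Pi_I)
  qed (use coord in auto)
  then have "(\<lambda>x. x) \<in> measurable ?\<Sigma> (Xpow d)" by (simp add: Xpow_def)
  then show "sets (Xpow d) \<subseteq> sigma_sets (space (Xpow d)) (generator d N)"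
    unfolding s(2)[symmetric]
  proof (intro subsetI)
    fix A assume "(\<lambda>x. x) \<in> measurable ?\<Sigma> (Xpow d)" "A \<in> sets (Xpow d)"
    then have "(\<lambda>x. x) -` A \<inter> space ?\<Sigma> \<in> sets ?\<Sigma>" by (rule measurable_sets)
    moreover have "(\<lambda>x. x) -` A \<inter> space ?\<Sigma> = A"
      using sets.sets_into_space[OF \<open>A \<in> sets (Xpow d)\<close>] s(1) by auto
    ultimately show "A \<in> sets ?\<Sigma>" by simp
  qed
qed

section \<open>Measures on a nested sequence of diagonals\<close>

lemma preserves_funpow: "preserves M f \<Longrightarrow> preserves M (f ^^ k)"
proof (induction k)
  case (Suc k)
  then have p: "f ^^ k \<in> measurable M M" "f \<in> measurable M M"
    "\<And>A. A \<in> sets M \<Longrightarrow> emeasure M (f -` A \<inter> space M) = emeasure M A"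
    "\<And>A. A \<in> sets M \<Longrightarrow> emeasure M ((f ^^ k) -` A \<inter> space M) = emeasure M A"
    by (auto simp: preserves_def)
  have "emeasure M ((f ^^ Suc k) -` A \<inter> space M) = emeasure M A" if "A \<in> sets M" for A
  proof -
    have "(f ^^ Suc k) -` A \<inter> space M = (f ^^ k) -` (f -` A \<inter> space M) \<inter> space M"
      using measurable_space[OF p(1)] by auto
    then have "emeasure M ((f ^^ Suc k) -` A \<inter> space M) = emeasure M (f -` A \<inter> space M)"
      by (simp only: p(4)[OF measurable_sets[OF p(2) that]])
    then show ?thesis by (simp only: p(3)[OF that])
  qed
  moreover have "f ^^ Suc k \<in> measurable M M" using p(1,2) by simp
  ultimately show ?case unfolding preserves_def by blast
qed (auto simp: preserves_def)

lemma infinite_ge: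
  fixes S :: "nat set"
  assumes "infinite S"
  shows "infinite {n \<in> S. n \<ge> m}"
proof
  assume "finite {n \<in> S. n \<ge> m}"
  then have "finite ({n \<in> S. n \<ge> m} \<union> {..<m})" by simp
  moreover have "S \<subseteq> {n \<in> S. n \<ge> m} \<union> {..<m}" by auto
  ultimately show False using assms finite_subset by blast
qed

text \<open>This governs both the mass of a box under central cases and the length of a set of points with
prescribed digits.\<close>

lemma halving_tendsto_0:
  fixes r :: "nat \<Rightarrow> real"
  assumes nonneg: "\<And>n. r n \<ge> 0" and mono: "\<And>n. n \<ge> m \<Longrightarrow> r (Suc n) \<le> r n"
    and half: "infinite {n. n \<ge> m \<and> r (Suc n) \<le> r n / 2}"
  shows "r \<longlonglongrightarrow> 0"
proof -
  have dec: "decseq (\<lambda>n. r (n + m))" by (rule decseq_SucI) (use mono in auto)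
  obtain L where L: "(\<lambda>n. r (n + m)) \<longlonglongrightarrow> L" "\<forall>i. L \<le> r (i + m)"
    using decseq_convergent[OF dec, of 0] nonneg by blast
  have lim: "r \<longlonglongrightarrow> L" using L(1) by (rule LIMSEQ_offset)
  have "L \<ge> 0" using lim nonneg by (intro LIMSEQ_le_const) auto
  moreover have "\<not> L > 0"
  proof
    assume "L > 0"
    then have "\<forall>\<^sub>F n in sequentially. r n < 2 * L" using lim by (intro order_tendstoD) auto
    then obtain n0 where n0: "\<forall>n\<ge>n0. r n < 2 * L" unfolding eventually_sequentially by blast
    obtain n where n: "n \<ge> max n0 m" "n \<ge> m" "r (Suc n) \<le> r n / 2"
      using half unfolding infinite_nat_iff_unbounded_le by blast
    have "L \<le> r (Suc n)" using L(2)[rule_format, of "Suc n - m"] n by simp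
    then show False using n0 n by fastforce
  qed
  ultimately show ?thesis using lim by simp
qed

lemma diagonal_base:
  assumes d: "d \<ge> 1" and j: "\<forall>i\<in>{1..d}. j i < half n"
  obtains j0 where "\<forall>i\<in>{1..d}. j0 i < half n" "cell d n j0 \<in> diagonal_of d n j"
    "\<And>B. B \<in> diagonal_of d n j \<Longrightarrow> \<exists>k. B = cell d n (\<lambda>i. j0 i + k) \<and> (\<forall>i\<in>{1..d}. j0 i + k < half n)"
proof -
  have I: "finite (j ` {1..d})" "j ` {1..d} \<noteq> {}" using d by (auto simp: atLeastAtMost_iff)
  define m where "m = Min (j ` {1..d})"
  obtain a where a: "a \<in> {1..d}" "j a = m" using Min_in[OF I] unfolding m_def by force
  have bd: "m \<le> j i" if "i \<in> {1..d}" for i using that I unfolding m_def by auto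
  show ?thesis
  proof (rule that[of "\<lambda>i. j i - m"])
    show "\<forall>i\<in>{1..d}. j i - m < half n" using j by auto
    then show "cell d n (\<lambda>i. j i - m) \<in> diagonal_of d n j"
      unfolding diagonal_of_def using bd
      by (auto intro!: exI[of _ "\<lambda>i. j i - m"] exI[of _ "- int m"])
  next
    fix B assume "B \<in> diagonal_of d n j"
    then obtain j' k where j': "B = cell d n j'" "\<forall>i\<in>{1..d}. j' i < half n"
        "\<forall>i\<in>{1..d}. int (j' i) = int (j i) + k" by (auto simp: diagonal_of_def)
    have "int (j' a) = int m + k" using j' a by auto
    then have k: "int (nat (k + int m)) = k + int m" by linarith
    have e: "j' i = j i - m + nat (k + int m)" if "i \<in> {1..d}" for i
      using j'(3)[rule_format, OF that] bd[OF that] k by linarith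
    then have "B = cell d n (\<lambda>i. j i - m + nat (k + int m))" unfolding j'(1) by (rule cell_cong)
    then show "\<exists>k. B = cell d n (\<lambda>i. j i - m + k) \<and> (\<forall>i\<in>{1..d}. j i - m + k < half n)"
      using e j'(2) by metis
  qed
qed

lemma generatorE:
  assumes "B \<in> generator d N"
  obtains "B = {}" | n where "n \<ge> N" "B \<in> cells d n"
  using assms unfolding generator_def by auto

text \<open>
  An invariant measure with known diagonals from some \<open>N\<close> on. The diagonals are given by the indices
  \<open>J n\<close> of one of their cells, chosen so that the cell of \<open>J (n + 1)\<close> is the part of the cell of
  \<open>J n\<close> that is selected by \<open>\<tau> n\<close>.
\<close>

locale diagonal_sequence =
  fixes d :: nat and \<sigma> :: "(nat \<Rightarrow> real) measure" and N :: nat and J \<tau> :: "nat \<Rightarrow> nat \<Rightarrow> nat"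
  assumes d: "d \<ge> 1"
    and sets_\<sigma>: "sets \<sigma> = sets (Xpow d)"
    and bfin: "boundedly_finite d \<sigma>"
    and pres: "preserves \<sigma> (Tpow d)"
    and J_N: "\<forall>i\<in>{1..d}. J N i < half N"
    and J_Suc: "\<And>n. n \<ge> N \<Longrightarrow> J (Suc n) = (\<lambda>i. J n i + shift n (\<tau> n i))"
    and digits: "\<And>n. n \<ge> N \<Longrightarrow> \<forall>i\<in>{1..d}. \<tau> n i \<in> {1, 2, 3}"
    and conc: "\<And>n. n \<ge> N \<Longrightarrow> AE x in \<sigma>. x \<in> Cpow d n \<longrightarrow> x \<in> \<Union>(diagonal_of d n (J n))"
    and pos: "emeasure \<sigma> (Cpow d N) > 0"
begin

lemma space_\<sigma>: "space \<sigma> = space (Xpow d)"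
  using sets_\<sigma> by (rule sets_eq_imp_space_eq)

lemma J_half: "n \<ge> N \<Longrightarrow> \<forall>i\<in>{1..d}. J n i < half n"
proof (induction n rule: dec_induct)
  case (step n)
  then show ?case using shift_lt_half half_index by (auto simp: J_Suc)
qed (rule J_N)

lemma cell_J: "n \<ge> N \<Longrightarrow> cell d n (J n) \<in> diagonal_of d n (J n)"
  using J_half by (auto simp: diagonal_of_def)

lemma emeasure_cell_push:
  assumes "A \<in> sets \<sigma>" "\<forall>i\<in>{1..d}. j i + k < height n"
  shows "emeasure \<sigma> ((Tpow d ^^ k) -` A \<inter> cell d n j) = emeasure \<sigma> (A \<inter> cell d n (\<lambda>i. j i + k))"
proof -
  have j: "\<forall>i\<in>{1..d}. j i < height n" using assms(2) by auto
  have iff: "(Tpow d ^^ k) x \<in> cell d n (\<lambda>i. j i + k) \<longleftrightarrow> x \<in> cell d n j" if "x \<in> space \<sigma>" for x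
    using Tpow_pow_cell_iff[OF _ assms(2)] that space_\<sigma> by simp
  have "(Tpow d ^^ k) -` A \<inter> cell d n j = (Tpow d ^^ k) -` (A \<inter> cell d n (\<lambda>i. j i + k)) \<inter> space \<sigma>"
    using iff cell_subset_space[OF j] unfolding space_\<sigma> by blast
  moreover have "A \<inter> cell d n (\<lambda>i. j i + k) \<in> sets \<sigma>"
    using assms(1) cell_sets[OF assms(2)] sets_\<sigma> by auto
  ultimately show ?thesis using preserves_funpow[OF pres, of k] unfolding preserves_def by metis
qed

definition invariant :: "(nat \<Rightarrow> real) set \<Rightarrow> bool" where
  "invariant A \<longleftrightarrow> A \<in> sets \<sigma> \<and> Tpow d -` A \<inter> space \<sigma> = A"

lemma invariant_space: "invariant (space \<sigma>)"
  using Tpow_space unfolding invariant_def space_\<sigma> sets_\<sigma> by auto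

lemma invariant_funpow: "invariant A \<Longrightarrow> (Tpow d ^^ k) -` A \<inter> space \<sigma> = A"
proof (induction k)
  case 0
  then show ?case using sets.sets_into_space by (auto simp: invariant_def)
next
  case (Suc k)
  have "(Tpow d ^^ Suc k) -` A \<inter> space \<sigma> = Tpow d -` ((Tpow d ^^ k) -` A \<inter> space \<sigma>) \<inter> space \<sigma>"
    using Tpow_space unfolding space_\<sigma> by (auto simp: funpow_swap1)
  then show ?case using Suc.IH[OF Suc.prems] Suc.prems unfolding invariant_def by metis
qed

lemma emeasure_invariant_diagonal:
  assumes A: "invariant A" and n: "n \<ge> N" and B: "B \<in> diagonal_of d n (J n)"
  shows "emeasure \<sigma> (A \<inter> B) = emeasure \<sigma> (A \<inter> cell d n (J n))"
proof -
  obtain j0 where j0: "\<forall>i\<in>{1..d}. j0 i < half n"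
    "\<And>B. B \<in> diagonal_of d n (J n) \<Longrightarrow>
      \<exists>k. B = cell d n (\<lambda>i. j0 i + k) \<and> (\<forall>i\<in>{1..d}. j0 i + k < half n)"
    using diagonal_base[OF d J_half[OF n]] by metis
  have "emeasure \<sigma> (A \<inter> B) = emeasure \<sigma> (A \<inter> cell d n j0)" if "B \<in> diagonal_of d n (J n)" for B
  proof -
    obtain k where k: "B = cell d n (\<lambda>i. j0 i + k)" "\<forall>i\<in>{1..d}. j0 i + k < half n" using j0(2) \<open>B \<in> _\<close> by blast
    have "(Tpow d ^^ k) -` A \<inter> cell d n j0 = ((Tpow d ^^ k) -` A \<inter> space \<sigma>) \<inter> cell d n j0"
      using cell_subset_space[OF half_index[OF j0(1)]] space_\<sigma> by blast
    also have "\<dots> = A \<inter> cell d n j0" using invariant_funpow[OF A] by simp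
    finally show ?thesis
      unfolding k(1) using emeasure_cell_push[of A j0 k n] A half_index[OF k(2)] by (simp add: invariant_def)
  qed
  from this[OF B] this[OF cell_J[OF n]] show ?thesis by simp
qed

definition mass :: "nat \<Rightarrow> ennreal" where
  "mass n = emeasure \<sigma> (cell d n (J n))"

lemma mass_diagonal: "n \<ge> N \<Longrightarrow> B \<in> diagonal_of d n (J n) \<Longrightarrow> emeasure \<sigma> B = mass n"
  using emeasure_invariant_diagonal[OF invariant_space, of n B] cells_sets[of _ d n]
    diagonal_subset_cells[of d n "J n"] cell_J[of n] sets.sets_into_space[of _ "Xpow d"]
  unfolding mass_def space_\<sigma> by (metis inf.absorb_iff2 subsetD)

lemma mass_finite: "n \<ge> N \<Longrightarrow> mass n < \<infinity>"
proof -
  assume n: "n \<ge> N"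
  have "cell d n (J n) \<subseteq> Cpow d n" using CpowI J_half[OF n] by blast
  then have "mass n \<le> emeasure \<sigma> (Cpow d n)"
    unfolding mass_def using Cpow_sets sets_\<sigma> by (intro emeasure_mono) auto
  then show ?thesis using Cpow_finite[OF bfin, of n] by (rule le_less_trans)
qed

lemma cell_Suc_subset:
  assumes n: "n \<ge> N" and B: "B \<in> diagonal_of d (Suc n) (J (Suc n))" and x: "x \<in> B" "x \<in> cell d n (J n)"
  shows "B \<subseteq> cell d n (J n)"
proof -
  obtain j where j: "B = cell d (Suc n) j" "\<forall>i\<in>{1..d}. j i < half (Suc n)"
    using B diagonal_subset_cells unfolding cells_def by blast
  show ?thesis
    using cell_nested[OF x(2) half_index[OF J_half[OF n]] _ half_index[OF j(2)]] x(1) unfolding j(1) by simp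
qed

text \<open>The number \<open>K\<close> of cells of the next diagonal inside a cell of the present one is the same for all
invariant sets. This is what makes the proportion of an invariant set in a cell independent of \<open>n\<close>.\<close>

lemma emeasure_split:
  assumes "n \<ge> N"
  obtains K :: nat where "\<And>A. invariant A \<Longrightarrow>
    emeasure \<sigma> (A \<inter> cell d n (J n)) = of_nat K * emeasure \<sigma> (A \<inter> cell d (Suc n) (J (Suc n)))"
proof
  define F where "F = {B \<in> diagonal_of d (Suc n) (J (Suc n)). B \<subseteq> cell d n (J n)}"
  have F: "finite F" "F \<subseteq> cells d (Suc n)"
    using finite_subset[OF diagonal_subset_cells finite_cells, of d "Suc n" "J (Suc n)"]
      diagonal_subset_cells[of d "Suc n" "J (Suc n)"] unfolding F_def by auto
  fix A assume A: "invariant A"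
  then have As: "A \<in> sets \<sigma>" by (simp add: invariant_def)
  have meas: "A \<inter> B \<in> sets \<sigma>" if "B \<in> F" for B
    using F(2) cells_sets that As sets_\<sigma> by blast
  have "AE x in \<sigma>. x \<in> A \<inter> cell d n (J n) \<longleftrightarrow> x \<in> (\<Union>B\<in>F. A \<inter> B)"
    using conc[of "Suc n", OF le_SucI[OF assms]]
  proof eventually_elim
    case (elim x)
    have "x \<in> \<Union>F" if x: "x \<in> cell d n (J n)"
    proof -
      have "x \<in> Cpow d (Suc n)" using CpowI[OF x J_half[OF assms]] Cpow_mono[of n "Suc n"] by auto
      then obtain B where B: "B \<in> diagonal_of d (Suc n) (J (Suc n))" "x \<in> B" using elim by blast
      moreover have "B \<subseteq> cell d n (J n)" by (rule cell_Suc_subset[OF assms B x])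
      ultimately show ?thesis unfolding F_def by blast
    qed
    moreover have "\<Union>F \<subseteq> cell d n (J n)" unfolding F_def by blast
    ultimately show ?case by blast
  qed
  then have "emeasure \<sigma> (A \<inter> cell d n (J n)) = emeasure \<sigma> (\<Union>B\<in>F. A \<inter> B)"
  proof (rule emeasure_eq_AE)
    show "A \<inter> cell d n (J n) \<in> sets \<sigma>"
      using As cell_sets[OF half_index[OF J_half[OF assms]]] sets_\<sigma> by auto
    show "(\<Union>B\<in>F. A \<inter> B) \<in> sets \<sigma>" by (rule sets.finite_UN[OF F(1) meas])
  qed
  also have "\<dots> = (\<Sum>B\<in>F. emeasure \<sigma> (A \<inter> B))"
  proof (rule sum_emeasure[symmetric])
    have "B \<inter> B' = {}" if "B \<in> F" "B' \<in> F" "B \<noteq> B'" for B B'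
      using that F(2) cells_disjoint[of B d "Suc n" B'] by blast
    then show "disjoint_family_on (\<lambda>B. A \<inter> B) F" unfolding disjoint_family_on_def by blast
  qed (use meas F(1) in auto)
  also have "\<dots> = (\<Sum>B\<in>F. emeasure \<sigma> (A \<inter> cell d (Suc n) (J (Suc n))))"
    using emeasure_invariant_diagonal[OF A] assms unfolding F_def by (intro sum.cong) auto
  finally show "emeasure \<sigma> (A \<inter> cell d n (J n))
      = of_nat (card F) * emeasure \<sigma> (A \<inter> cell d (Suc n) (J (Suc n)))" by simp
qed

lemma space_Int_cell: "n \<ge> N \<Longrightarrow> space \<sigma> \<inter> cell d n (J n) = cell d n (J n)"
  using cell_subset_space[OF half_index[OF J_half]] unfolding space_\<sigma> by blast

lemma mass_split:
  assumes "n \<ge> N"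
  obtains K :: nat where "mass n = of_nat K * mass (Suc n)" "\<And>A. invariant A \<Longrightarrow>
    emeasure \<sigma> (A \<inter> cell d n (J n)) = of_nat K * emeasure \<sigma> (A \<inter> cell d (Suc n) (J (Suc n)))"
proof -
  obtain K :: nat where K: "\<And>A. invariant A \<Longrightarrow>
    emeasure \<sigma> (A \<inter> cell d n (J n)) = of_nat K * emeasure \<sigma> (A \<inter> cell d (Suc n) (J (Suc n)))"
    using emeasure_split[OF assms] by blast
  then show ?thesis
    using that[of K] K[OF invariant_space] space_Int_cell[OF assms] space_Int_cell[of "Suc n"] assms
    by (simp add: mass_def)
qed

lemma emeasure_Cpow_le:
  assumes n: "n \<ge> N" and W: "W \<in> sets \<sigma>"
  shows "emeasure \<sigma> (W \<inter> Cpow d n) \<le> (\<Sum>B\<in>diagonal_of d n (J n). emeasure \<sigma> (W \<inter> B))"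
proof -
  have fin: "finite (diagonal_of d n (J n))" using finite_subset[OF diagonal_subset_cells finite_cells] .
  have meas: "W \<inter> B \<in> sets \<sigma>" if "B \<in> diagonal_of d n (J n)" for B
    using that diagonal_subset_cells cells_sets W sets_\<sigma> by blast
  have "emeasure \<sigma> (W \<inter> Cpow d n) \<le> emeasure \<sigma> (\<Union>B\<in>diagonal_of d n (J n). W \<inter> B)"
  proof (rule emeasure_mono_AE)
    show "AE x in \<sigma>. x \<in> W \<inter> Cpow d n \<longrightarrow> x \<in> (\<Union>B\<in>diagonal_of d n (J n). W \<inter> B)"
      using conc[OF n] by eventually_elim blast
    show "(\<Union>B\<in>diagonal_of d n (J n). W \<inter> B) \<in> sets \<sigma>" by (rule sets.finite_UN[OF fin meas])
  qed
  also have "\<dots> \<le> (\<Sum>B\<in>diagonal_of d n (J n). emeasure \<sigma> (W \<inter> B))"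
    using meas fin by (intro emeasure_subadditive_finite) auto
  finally show ?thesis .
qed

lemma mass_nonzero: "n \<ge> N \<Longrightarrow> mass n \<noteq> 0"
proof (induction n rule: dec_induct)
  case base
  show ?case
  proof
    assume z: "mass N = 0"
    have "emeasure \<sigma> (space \<sigma> \<inter> B) = 0" if "B \<in> diagonal_of d N (J N)" for B
      using emeasure_invariant_diagonal[OF invariant_space order_refl that] space_Int_cell[of N] z
      by (simp add: mass_def)
    then have "emeasure \<sigma> (space \<sigma> \<inter> Cpow d N) = 0"
      using emeasure_Cpow_le[OF order_refl, of "space \<sigma>"] by simp
    moreover have "space \<sigma> \<inter> Cpow d N = Cpow d N"
      using sets.sets_into_space[OF Cpow_sets] space_\<sigma> by auto
    ultimately show False using pos by simp
  qed
next
  case (step n)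
  then show ?case using mass_split[of n] by fastforce
qed

text \<open>With \<open>c\<close> the common proportion of an invariant set \<open>A\<close> in the cells, the measures \<open>\<sigma>(A \<inter> _)\<close> and
\<open>c * \<sigma>\<close> agree on cells and hence everywhere. Evaluated at the complement of \<open>A\<close> this says that
\<open>c = 0\<close> or the complement is null, and if \<open>c = 0\<close> then \<open>A\<close> itself is null.\<close>

theorem ergodic: "ergodic \<sigma> (Tpow d)"
  unfolding ergodic_def
proof (intro conjI ballI impI pres)
  fix A assume As: "A \<in> sets \<sigma>" and inv: "Tpow d -` A \<inter> space \<sigma> = A"
  then have A: "invariant A" by (simp add: invariant_def)
  define c where "c = emeasure \<sigma> (A \<inter> cell d N (J N)) / mass N"
  have c: "emeasure \<sigma> (A \<inter> cell d n (J n)) = c * mass n" if "n \<ge> N" for n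
    using that
  proof (induction n rule: dec_induct)
    case base
    have "c * mass N = emeasure \<sigma> (A \<inter> cell d N (J N)) * mass N / mass N"
      unfolding c_def by (simp add: ennreal_divide_times ennreal_times_divide)
    then show ?case using mass_nonzero[of N] mass_finite[of N] by (simp add: ennreal_mult_divide_eq)
  next
    case (step n)
    obtain K :: nat where K: "mass n = of_nat K * mass (Suc n)"
      "emeasure \<sigma> (A \<inter> cell d n (J n)) = of_nat K * emeasure \<sigma> (A \<inter> cell d (Suc n) (J (Suc n)))"
      using mass_split[OF step(1)] A by metis
    have "K \<noteq> 0" using K(1) mass_nonzero[OF step(1)] by auto
    moreover have "of_nat K * emeasure \<sigma> (A \<inter> cell d (Suc n) (J (Suc n))) = of_nat K * (c * mass (Suc n))"
      using K step.IH by (simp add: ac_simps)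
    ultimately show ?case by (simp add: ennreal_mult_cancel_left)
  qed
  \<comment> \<open>A cell off the diagonal has measure zero, so \<open>c\<close> works for it as well.\<close>
  have gen: "emeasure \<sigma> (A \<inter> B) = c * emeasure \<sigma> B" if B: "B \<in> generator d N" for B
  proof (cases "B = {}")
    case False
    then obtain n where n: "n \<ge> N" "B \<in> cells d n" using generatorE[OF B] by metis
    have Bs: "B \<in> sets \<sigma>" using cells_sets[OF n(2)] sets_\<sigma> by simp
    show ?thesis
    proof (cases "B \<in> diagonal_of d n (J n)")
      case True
      then show ?thesis using emeasure_invariant_diagonal[OF A n(1)] c[OF n(1)] mass_diagonal[OF n(1)] by simp
    next
      case F: False
      have "AE x in \<sigma>. x \<notin> B"
        using conc[OF n(1)]
      proof eventually_elim
        case (elim x)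
        show ?case
        proof
          assume x: "x \<in> B"
          then have "x \<in> Cpow d n" using n(2) Union_cells by blast
          then obtain B' where B': "B' \<in> diagonal_of d n (J n)" "x \<in> B'" using elim by blast
          then have "B = B'" using cells_disjoint[OF n(2) _ x] diagonal_subset_cells by blast
          then show False using F B' by simp
        qed
      qed
      then have "emeasure \<sigma> B = 0" using Bs by (subst (asm) AE_iff_measurable[OF _ refl])
          (use sets.sets_into_space[OF Bs] in \<open>auto simp: Int_absorb1 Collect_conj_eq\<close>)
      moreover have "emeasure \<sigma> (A \<inter> B) \<le> emeasure \<sigma> B" using Bs by (intro emeasure_mono) auto
      ultimately show ?thesis by simp
    qed
  qed simp
  have eq: "density \<sigma> (indicator A) = scale_measure c \<sigma>"
  proof (rule measure_eqI_generator_eq_countable[OF Int_stable_generator[of d N], where A = "generator d N"])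
    show "generator d N \<subseteq> Pow (space (Xpow d))" using generator_sets sets.sets_into_space by blast
    show "sets (density \<sigma> (indicator A)) = sigma_sets (space (Xpow d)) (generator d N)"
      "sets (scale_measure c \<sigma>) = sigma_sets (space (Xpow d)) (generator d N)"
      by (simp_all add: sets_\<sigma> sets_Xpow_generator[symmetric])
    show "emeasure (density \<sigma> (indicator A)) B = emeasure (scale_measure c \<sigma>) B" if "B \<in> generator d N" for B
      using generator_sets[OF that] As by (simp add: emeasure_restricted sets_\<sigma> gen[OF that])
    show "\<Union>(generator d N) = space (Xpow d)"
    proof
      show "\<Union>(generator d N) \<subseteq> space (Xpow d)" using generator_sets sets.sets_into_space by blast
      show "space (Xpow d) \<subseteq> \<Union>(generator d N)"
      proof
        fix x assume "x \<in> space (Xpow d)"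
        then obtain n where "n \<ge> N" "x \<in> Cpow d n" using Cpow_exhausts by blast
        then show "x \<in> \<Union>(generator d N)" unfolding generator_def Union_cells[symmetric] by auto
      qed
    qed
    show "emeasure (density \<sigma> (indicator A)) B \<noteq> \<infinity>" if B: "B \<in> generator d N" for B
    proof -
      obtain n where n: "B \<subseteq> Cpow d n" using generatorE[OF B] Union_cells by (metis Sup_upper empty_subsetI)
      have "emeasure \<sigma> (A \<inter> B) \<le> emeasure \<sigma> (Cpow d n)"
        using n Cpow_sets sets_\<sigma> by (intro emeasure_mono) auto
      then have "emeasure \<sigma> (A \<inter> B) < \<infinity>" using Cpow_finite[OF bfin] by (rule le_less_trans)
      then show ?thesis
        using generator_sets[OF B] As by (simp add: emeasure_restricted sets_\<sigma>)
    qed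
  qed (use countable_generator in auto)
  have all: "emeasure \<sigma> (A \<inter> X) = c * emeasure \<sigma> X" if "X \<in> sets \<sigma>" for X
    using arg_cong[OF eq, of "\<lambda>M. emeasure M X"] As that by (simp add: emeasure_restricted)
  show "emeasure \<sigma> A = 0 \<or> emeasure \<sigma> (space \<sigma> - A) = 0"
    using all[of A] all[of "space \<sigma> - A"] As by auto
qed

lemma mass_Suc_le: "n \<ge> N \<Longrightarrow> mass (Suc n) \<le> mass n"
proof -
  assume n: "n \<ge> N"
  obtain K :: nat where K: "mass n = of_nat K * mass (Suc n)" using mass_split[OF n] by metis
  have "K \<noteq> 0" using K mass_nonzero[OF n] by auto
  then have "1 * mass (Suc n) \<le> of_nat K * mass (Suc n)" by (intro mult_right_mono) auto
  then show ?thesis using K by simp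
qed

text \<open>When all coordinates are in the first subcolumn, the image after \<open>h\<close> steps has all coordinates in the
second one, at the same levels of tower \<open>n\<close>. Both cells are on the next diagonal and inside the same
cell of the present one.\<close>

lemma mass_central:
  assumes n: "n \<ge> N" and central: "central_case d (\<tau> n)"
  shows "2 * mass (Suc n) \<le> mass n"
proof -
  define p where "p k = cell d (Suc n) (\<lambda>i. J n i + shift n k)" for k
  have h: "\<forall>i\<in>{1..d}. J n i < height n" using half_index[OF J_half[OF n]] .
  have \<tau>: "\<tau> n i = 1" if "i \<in> {1..d}" for i using central that by (simp add: central_case_def)
  have D: "p k \<in> diagonal_of d (Suc n) (J (Suc n))" if "k \<in> {1, 2}" for k
    unfolding diagonal_of_def p_def J_Suc[OF n] mem_Collect_eq
  proof (intro exI[of _ "\<lambda>i. J n i + shift n k"] conjI refl exI[of _ "int (shift n k)"])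
    show "\<forall>i\<in>{1..d}. J n i + shift n k < half (Suc n)" using h shift_lt_half by blast
    show "\<forall>i\<in>{1..d}. int (J n i + shift n k) = int (J n i + shift n (\<tau> n i)) + int (shift n k)"
      using \<tau> by (simp add: shift_def)
  qed
  have sub: "p k \<subseteq> cell d n (J n)" if "k \<in> {1, 2}" for k
    using that h level_Suc_subset unfolding p_def by (fastforce simp: mem_cell)
  have "p 1 \<inter> p 2 = {}"
  proof (rule ccontr)
    assume "p 1 \<inter> p 2 \<noteq> {}"
    then obtain x where x: "x \<in> p 1" "x \<in> p 2" by blast
    have 1: "1 \<in> {1..d}" using d by (simp add: atLeastAtMost_iff)
    have "J n 1 + shift n 1 = J n 1 + shift n 2"
      by (rule cell_index_unique[OF x[unfolded p_def] _ _ 1]) (use h shift_lt_height in blast)+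
    then show False using height_ge1[of n] by (simp add: shift_def)
  qed
  moreover have meas: "p k \<in> sets \<sigma>" if "k \<in> {1, 2}" for k
    using D[OF that] diagonal_subset_cells cells_sets sets_\<sigma> by blast
  ultimately have "emeasure \<sigma> (p 1 \<union> p 2) = emeasure \<sigma> (p 1) + emeasure \<sigma> (p 2)"
    using plus_emeasure[of "p 1" \<sigma> "p 2"] by simp
  moreover have "emeasure \<sigma> (p 1 \<union> p 2) \<le> mass n"
    unfolding mass_def using sub[of 1] sub[of 2] cell_sets[OF h] sets_\<sigma> by (intro emeasure_mono) auto
  ultimately show ?thesis
    using mass_diagonal[OF le_SucI[OF n] D] by (simp add: mult_2)
qed

lemma mass_tendsto_0:
  assumes "infinite {n. n \<ge> N \<and> central_case d (\<tau> n)}"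
  shows "(\<lambda>n. enn2real (mass n)) \<longlonglongrightarrow> 0"
proof (rule halving_tendsto_0[of _ N])
  have fin: "mass n < top" if "n \<ge> N" for n using mass_finite[OF that] by simp
  show "enn2real (mass (Suc n)) \<le> enn2real (mass n)" if "n \<ge> N" for n
    using mass_Suc_le[OF that] fin[OF that] by (rule enn2real_mono)
  have "enn2real (mass (Suc n)) \<le> enn2real (mass n) / 2" if "n \<ge> N" "central_case d (\<tau> n)" for n
    using enn2real_mono[OF mass_central[OF that] fin[OF that(1)]] by (simp add: enn2real_mult)
  then show "infinite {n. n \<ge> N \<and> enn2real (mass (Suc n)) \<le> enn2real (mass n) / 2}"
    using assms by (elim infinite_super[rotated]) auto
qed simp

text \<open>The parts of \<open>W\<close> in the cells of the diagonal are carried back to the first cell by powers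
of the transformation, without loss of mass. As \<open>W\<close> is wandering they are disjoint there.\<close>

lemma wandering_le_mass:
  assumes n: "n \<ge> N" and W: "W \<in> sets \<sigma>" and wander: "disjoint_family (\<lambda>k. (Tpow d ^^ k) -` W \<inter> space \<sigma>)"
  shows "emeasure \<sigma> (W \<inter> Cpow d n) \<le> mass n"
proof -
  obtain j0 where j0: "\<forall>i\<in>{1..d}. j0 i < half n" "cell d n j0 \<in> diagonal_of d n (J n)"
    "\<And>B. B \<in> diagonal_of d n (J n) \<Longrightarrow>
      \<exists>k. B = cell d n (\<lambda>i. j0 i + k) \<and> (\<forall>i\<in>{1..d}. j0 i + k < half n)"
    using diagonal_base[OF d J_half[OF n]] by metis
  define K where "K = {k. \<forall>i\<in>{1..d}. j0 i + k < half n}"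
  have 1: "1 \<in> {1..d}" using d by (simp add: atLeastAtMost_iff)
  have K: "finite K" by (rule finite_subset[of _ "{..<half n}"]) (use 1 in \<open>auto simp: K_def\<close>)
  have Kh: "\<forall>i\<in>{1..d}. j0 i + k < height n" if "k \<in> K" for k 
    using that half_index[of "{1..d}" "\<lambda>i. j0 i + k" n] unfolding K_def by simp
  have sp: "cell d n j0 \<subseteq> space \<sigma>" using cell_subset_space[OF half_index[OF j0(1)]] unfolding space_\<sigma> .
  have c0: "cell d n j0 \<in> sets \<sigma>" using cell_sets[OF half_index[OF j0(1)]] sets_\<sigma> by simp
  have meas: "(Tpow d ^^ k) -` W \<inter> cell d n j0 \<in> sets \<sigma>" for k
  proof -
    have "(Tpow d ^^ k) -` W \<inter> space \<sigma> \<in> sets \<sigma>"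
      using preserves_funpow[OF pres, of k] W measurable_sets unfolding preserves_def by blast
    moreover have "(Tpow d ^^ k) -` W \<inter> cell d n j0 = ((Tpow d ^^ k) -` W \<inter> space \<sigma>) \<inter> cell d n j0"
      using sp by blast
    ultimately show ?thesis using c0 by auto
  qed
  have "emeasure \<sigma> (W \<inter> Cpow d n) \<le> (\<Sum>B\<in>diagonal_of d n (J n). emeasure \<sigma> (W \<inter> B))"
    by (rule emeasure_Cpow_le[OF n W])
  also have "\<dots> \<le> (\<Sum>B\<in>(\<lambda>k. cell d n (\<lambda>i. j0 i + k)) ` K. emeasure \<sigma> (W \<inter> B))"
    using j0(3) K by (intro sum_mono2) (auto simp: K_def)
  also have "\<dots> \<le> (\<Sum>k\<in>K. emeasure \<sigma> (W \<inter> cell d n (\<lambda>i. j0 i + k)))"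
    using sum_image_le[OF K, of "\<lambda>B. emeasure \<sigma> (W \<inter> B)" "\<lambda>k. cell d n (\<lambda>i. j0 i + k)"] by (simp add: comp_def)
  also have "\<dots> = (\<Sum>k\<in>K. emeasure \<sigma> ((Tpow d ^^ k) -` W \<inter> cell d n j0))"
    using emeasure_cell_push[OF W Kh] by (intro sum.cong) auto
  also have "\<dots> = emeasure \<sigma> (\<Union>k\<in>K. (Tpow d ^^ k) -` W \<inter> cell d n j0)"
  proof (rule sum_emeasure)
    show "disjoint_family_on (\<lambda>k. (Tpow d ^^ k) -` W \<inter> cell d n j0) K"
      using wander sp unfolding disjoint_family_on_def by blast
  qed (use meas K in auto)
  also have "\<dots> \<le> emeasure \<sigma> (cell d n j0)" using c0 by (intro emeasure_mono) auto
  also have "\<dots> = mass n" by (rule mass_diagonal[OF n j0(2)])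
  finally show ?thesis .
qed

theorem conservative:
  assumes "infinite {n. n \<ge> N \<and> central_case d (\<tau> n)}"
  shows "conservative \<sigma> (Tpow d)"
  unfolding conservative_def
proof (intro ballI impI)
  fix W assume W: "W \<in> sets \<sigma>" "disjoint_family (\<lambda>n. (Tpow d ^^ n) -` W \<inter> space \<sigma>)"
  have z: "emeasure \<sigma> (W \<inter> Cpow d n) = 0" for n
  proof -
    have "emeasure \<sigma> (W \<inter> Cpow d n) \<le> mass m" if "m \<ge> max N n" for m
      using wandering_le_mass[OF _ W, of m] that Cpow_mono[of n m] Cpow_sets[of d m] W(1) sets_\<sigma>
      by (intro order_trans[OF emeasure_mono[of "W \<inter> Cpow d n" "W \<inter> Cpow d m"]]) auto
    then have "ennreal (enn2real (emeasure \<sigma> (W \<inter> Cpow d n))) \<le> ennreal (enn2real (mass m))" if "m \<ge> max N n" for m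
      using that mass_finite[of m] by (intro ennreal_leI enn2real_mono) auto
    then have "enn2real (emeasure \<sigma> (W \<inter> Cpow d n)) \<le> 0"
      using mass_tendsto_0[OF assms] by (intro LIMSEQ_le_const) (auto intro!: exI[of _ "max N n"])
    then have "enn2real (emeasure \<sigma> (W \<inter> Cpow d n)) = 0" using enn2real_nonneg by (rule antisym)
    moreover have "emeasure \<sigma> (W \<inter> Cpow d n) \<le> emeasure \<sigma> (Cpow d n)"
      using Cpow_sets sets_\<sigma> by (intro emeasure_mono) auto
    ultimately show ?thesis
      using Cpow_finite[OF bfin, of n] unfolding enn2real_eq_0_iff by (auto simp: top_unique)
  qed
  have "W \<subseteq> (\<Union>n. W \<inter> Cpow d n)"
  proof
    fix x assume x: "x \<in> W"
    then have "x \<in> space (Xpow d)" using sets.sets_into_space[OF W(1)] space_\<sigma> by auto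
    then obtain n where "x \<in> Cpow d n" using Cpow_exhausts[of x d 0] by metis
    then show "x \<in> (\<Union>n. W \<inter> Cpow d n)" using x by blast
  qed
  then have "(\<Union>n. W \<inter> Cpow d n) = W" by (intro equalityI) auto
  moreover have "emeasure \<sigma> (\<Union>n. W \<inter> Cpow d n) = 0"
    using z W(1) Cpow_sets sets_\<sigma> by (intro emeasure_UN_eq_0) auto
  ultimately show "emeasure \<sigma> W = 0" by simp
qed

end

section \<open>Points with prescribed digits\<close>

text \<open>Being in the first, second or third subcolumn is the \<open>n\<close>th ternary digit of the position inside a level
of an earlier tower. The set \<open>C m\<close> makes sure that the point is in tower \<open>n\<close> for all \<open>n \<ge> m\<close>.\<close>

definition prescribed_digits :: "nat set \<Rightarrow> (nat \<Rightarrow> nat) \<Rightarrow> nat \<Rightarrow> real set" where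
  "prescribed_digits S \<delta> m = C m \<inter> (\<Inter>n\<in>{n \<in> S. n \<ge> m}. subcolumn n (\<delta> n))"

lemma subcolumn_borel: "subcolumn n k \<in> sets borel"
  unfolding subcolumn_def by (intro sets.finite_UN) auto

lemma prescribed_digits_sets: "prescribed_digits S \<delta> m \<in> sets mu"
proof -
  have "prescribed_digits S \<delta> m = C m \<inter> (\<Inter>n. if n \<in> S \<and> n \<ge> m then subcolumn n (\<delta> n) else UNIV)"
    unfolding prescribed_digits_def by auto
  moreover have "\<dots> \<in> sets borel"
    using C_borel subcolumn_borel by (intro sets.Int sets.countable_INT) auto
  moreover have "prescribed_digits S \<delta> m \<subseteq> {0..}"
    using C_subset_interval[of m] unfolding prescribed_digits_def by auto
  ultimately show ?thesis by (simp add: sets_mu)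
qed

text \<open>The set is covered by the levels of tower \<open>n\<close> that it meets. From \<open>n\<close> to \<open>n + 1\<close> their number grows at
most threefold, and it does not grow when the digit is prescribed, while their length is divided by
three. So the total length decreases, and is divided by three infinitely often.\<close>

lemma prescribed_digits_null:
  assumes S: "infinite S" and \<delta>: "\<forall>n\<in>S. \<delta> n \<in> {1, 2, 3}"
  shows "prescribed_digits S \<delta> m \<in> null_sets mu"
proof -
  define F where "F = prescribed_digits S \<delta> m"
  define K where "K n = {i \<in> {..<height n}. level n i \<inter> F \<noteq> {}}" for n
  have finK: "finite (K n)" for n by (simp add: K_def)
  have FC: "F \<subseteq> C n" if "n \<ge> m" for n using C_mono[OF that] by (auto simp: F_def prescribed_digits_def)
  have cover: "F \<subseteq> (\<Union>i\<in>K n. level n i)" if n: "n \<ge> m" for n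
  proof
    fix x assume x: "x \<in> F"
    then obtain i where "i < half n" "x \<in> level n i" using FC[OF n] by (auto simp: C_def)
    moreover from this have "i \<in> K n" using x half_lt_height[of n] by (auto simp: K_def)
    ultimately show "x \<in> (\<Union>i\<in>K n. level n i)" by blast
  qed
  have step: "K (Suc n) \<subseteq> (\<Union>k\<in>Q. (\<lambda>i. i + shift n k) ` K n)"
    if n: "n \<ge> m" and Q: "\<And>x i k. \<lbrakk>x \<in> F; i < height n; k \<in> {1, 2, 3}; x \<in> level (Suc n) (i + shift n k)\<rbrakk> \<Longrightarrow> k \<in> Q" for n Q
  proof
    fix i' assume "i' \<in> K (Suc n)"
    then obtain x where x: "i' < height (Suc n)" "x \<in> level (Suc n) i'" "x \<in> F" by (auto simp: K_def)
    then obtain i where i: "i \<in> K n" "x \<in> level n i" using cover[OF n] by blast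
    then have ih: "i < height n" by (simp add: K_def)
    obtain k where k: "k \<in> {1, 2, 3}" "x \<in> level (Suc n) (i + shift n k)" using level_splitE[OF i(2) ih] by metis
    have "i' = i + shift n k" using level_eq_index[OF x(2) k(2) x(1) shift_lt_height[OF ih]] .
    moreover have "k \<in> Q" by (rule Q[OF x(3) ih k])
    ultimately show "i' \<in> (\<Union>k\<in>Q. (\<lambda>i. i + shift n k) ` K n)" using i(1) by blast
  qed
  have card_step: "card (K (Suc n)) \<le> card Q * card (K n)"
    if "K (Suc n) \<subseteq> (\<Union>k\<in>Q. (\<lambda>i. i + shift n k) ` K n)" "finite Q" for n and Q :: "nat set"
  proof -
    have "card (K (Suc n)) \<le> card (\<Union>k\<in>Q. (\<lambda>i. i + shift n k) ` K n)"
      using that finK by (intro card_mono) auto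
    also have "\<dots> \<le> (\<Sum>k\<in>Q. card ((\<lambda>i. i + shift n k) ` K n))" by (rule card_UN_le[OF that(2)])
    also have "\<dots> \<le> (\<Sum>k\<in>Q. card (K n))" by (intro sum_mono card_image_le finK)
    finally show ?thesis by simp
  qed
  define r where "r n = real (card (K n)) / 3 ^ n" for n
  have lim: "r \<longlonglongrightarrow> 0"
  proof (rule halving_tendsto_0[of _ m])
    show "r (Suc n) \<le> r n" if n: "n \<ge> m" for n
    proof -
      have "card (K (Suc n)) \<le> card {1, 2, 3 :: nat} * card (K n)"
        by (intro card_step step n) auto
      then have "real (card (K (Suc n))) \<le> 3 * real (card (K n))" by simp
      then show ?thesis by (simp add: r_def field_simps)
    qed
    have "r (Suc n) \<le> r n / 2" if n: "n \<ge> m" "n \<in> S" for n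
    proof -
      have "card (K (Suc n)) \<le> card {\<delta> n} * card (K n)"
      proof (intro card_step step n(1))
        fix x i k
        assume a: "x \<in> F" "i < height n" "k \<in> {1, 2, 3}" "x \<in> level (Suc n) (i + shift n k)"
        have \<delta>n: "\<delta> n \<in> {1, 2, 3}" using \<delta> n(2) by blast
        have "x \<in> subcolumn n (\<delta> n)" using a(1) n by (auto simp: F_def prescribed_digits_def)
        then obtain i' where i': "i' < height n" "x \<in> level (Suc n) (i' + shift n (\<delta> n))"
          unfolding subcolumn_eq[OF \<delta>n] by blast
        have "k = \<delta> n" using t_eq[OF a(2,3,4)] t_eq[OF i'(1) \<delta>n i'(2)] by simp
        then show "k \<in> {\<delta> n}" by simp
      qed auto
      then have "real (card (K (Suc n))) \<le> real (card (K n))" by simp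
      moreover have "real (card (K n)) \<ge> 0" by simp
      ultimately have "2 * real (card (K (Suc n))) \<le> 3 * real (card (K n))" by linarith
      then show ?thesis by (simp add: r_def field_simps)
    qed
    moreover have "infinite {n \<in> S. n \<ge> m}" by (rule infinite_ge[OF S])
    ultimately show "infinite {n. n \<ge> m \<and> r (Suc n) \<le> r n / 2}" by (elim infinite_super[rotated]) auto
  qed (simp add: r_def)
  have "emeasure mu F \<le> ennreal (r n)" if "n \<ge> m" for n
  proof -
    have "emeasure mu F \<le> emeasure mu (\<Union>i\<in>K n. level n i)"
      using cover[OF that] level_sets_mu finK by (intro emeasure_mono sets.finite_UN) (auto simp: K_def)
    also have "\<dots> \<le> (\<Sum>i\<in>K n. emeasure mu (level n i))"
      using level_sets_mu finK by (intro emeasure_subadditive_finite) (auto simp: K_def)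
    also have "\<dots> = (\<Sum>i\<in>K n. ennreal (1 / 3 ^ n))"
    proof (intro sum.cong refl)
      fix i assume "i \<in> K n"
      then have "level n i \<subseteq> {0..}" using level_nonneg by (auto simp: K_def)
      then have "emeasure mu (level n i) = emeasure lborel (level n i)" by (rule emeasure_mu)
      then show "emeasure mu (level n i) = ennreal (1 / 3 ^ n)" by (simp add: level_def)
    qed
    also have "\<dots> = ennreal (r n)" by (simp add: r_def ennreal_of_nat_eq_real_of_nat ennreal_mult[symmetric])
    finally show ?thesis .
  qed
  moreover have "(\<lambda>n. ennreal (r n)) \<longlonglongrightarrow> ennreal 0" using lim by (intro tendsto_ennrealI)
  ultimately have "emeasure mu F \<le> ennreal 0" by (intro LIMSEQ_le_const) auto
  then show ?thesis using prescribed_digits_sets unfolding F_def by (auto simp: null_sets_def)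
qed

lemma (in diagonal_sequence) concentrated_null:
  assumes "infinite {n. n \<ge> N \<and> corner_case d (\<tau> n)}"
  shows "\<exists>Z. (\<forall>i\<in>{1..d}. Z i \<in> null_sets mu) \<and> concentrated_on \<sigma> (PiE {1..d} Z)"
proof (intro exI conjI ballI)
  let ?S = "{n. n \<ge> N \<and> corner_case d (\<tau> n)}"
  let ?Z = "\<lambda>i. \<Union>m. prescribed_digits ?S (\<lambda>n. \<tau> n i) m"
  show "?Z i \<in> null_sets mu" if "i \<in> {1..d}" for i
    using digits that by (intro null_sets_UN prescribed_digits_null assms) blast
  have "AE x in \<sigma>. \<forall>n. n \<ge> Suc N \<longrightarrow> x \<in> Cpow d n \<longrightarrow> x \<in> \<Union>(diagonal_of d n (J n))"
    unfolding AE_all_countable using conc by auto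
  then show "concentrated_on \<sigma> (PiE {1..d} ?Z)"
    unfolding concentrated_on_def using AE_space
  proof eventually_elim
    case (elim x)
    have x: "x \<in> space (Xpow d)" using elim(2) space_\<sigma> by simp
    obtain m where m: "m \<ge> N" "x \<in> Cpow d m" using Cpow_exhausts[OF x, of N] by metis
    have sub: "x i \<in> subcolumn n (\<tau> n i)" if n: "n \<ge> m" "n \<in> ?S" and i: "i \<in> {1..d}" for n i
    proof -
      have N: "n \<ge> N" and c: "corner_case d (\<tau> n)" using n(2) by auto
      have xC: "x \<in> Cpow d n" "x \<in> Cpow d (Suc n)" using m(2) Cpow_mono[of m n d] Cpow_mono[of m "Suc n" d] n(1) by auto
      then have "x \<in> \<Union>(diagonal_of d (Suc n) (J (Suc n)))" using elim(1) N by auto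
      then obtain q k where q: "x \<in> cell d (Suc n) q" "\<forall>i\<in>{1..d}. q i < half (Suc n)"
        "\<forall>i\<in>{1..d}. int (q i) = int (J n i + shift n (\<tau> n i)) + k"
        unfolding diagonal_of_def J_Suc[OF N] by blast
      show ?thesis using corner_descend[OF c J_half[OF N] digits[OF N] xC(1) q] i by metis
    qed
    have "x i \<in> prescribed_digits ?S (\<lambda>n. \<tau> n i) m" if i: "i \<in> {1..d}" for i
      using sub i m(2) unfolding prescribed_digits_def Cpow_def by (auto simp: PiE_iff)
    then show ?case using x unfolding PiE_iff mem_space_Xpow by blast
  qed
qed

section \<open>The measures with given parameters\<close>

text \<open>The first marginal of a graph joining is a positive multiple of \<open>\<mu>\<close>. It cannot vanish on the set \<open>U\<close> of
measure \<open>1\<close> outside \<open>Z 1\<close>.\<close>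

lemma not_graph_joining:
  assumes d: "d \<ge> 1" and Z: "\<forall>i\<in>{1..d}. Z i \<in> null_sets mu"
    and conc: "concentrated_on \<sigma> (PiE {1..d} Z)"
  shows "\<not> graph_joining d \<sigma>"
proof
  assume "graph_joining d \<sigma>"
  then obtain \<alpha> :: real and S where sets_\<sigma>: "sets \<sigma> = sets (Xpow d)" and \<alpha>: "\<alpha> > 0"
    and S: "\<forall>i\<in>{2..d}. preserves mu (S i)"
    and joint: "\<And>A. (\<forall>i\<in>{1..d}. A i \<in> sets mu) \<Longrightarrow> emeasure \<sigma> (PiE {1..d} A)
             = ennreal \<alpha> * emeasure mu (A 1 \<inter> (\<Inter>i\<in>{2..d}. S i -` A i))"
    unfolding graph_joining_def by blast
  have 1: "1 \<in> {1..d}" using d by (simp add: atLeastAtMost_iff)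
  have Z1: "Z 1 \<in> null_sets mu" using Z 1 by blast
  define U where "U = {0..<1} - Z 1"
  have I: "{0..<1} \<in> sets mu" by (auto simp: sets_mu)
  have U: "U \<in> sets mu" unfolding U_def using I Z1 by auto
  have "emeasure mu U = emeasure mu {0..<1}" unfolding U_def using Z1 I by (rule emeasure_Diff_null_set)
  also have "\<dots> = 1" by (subst emeasure_mu) auto
  finally have mU: "emeasure mu U = 1" .
  let ?A = "(\<lambda>i. if i = 1 then U else space mu) :: nat \<Rightarrow> real set"
  have A: "\<forall>i\<in>{1..d}. ?A i \<in> sets mu" using U by auto
  have "x \<in> S i -` ?A i" if "x \<in> U" "i \<in> {2..d}" for x i
  proof -
    have "S i \<in> measurable mu mu" using S that(2) unfolding preserves_def by blast
    moreover have "x \<in> space mu" using that(1) U sets.sets_into_space by blast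
    moreover have "i \<noteq> 1" using that(2) by (simp add: atLeastAtMost_iff)
    ultimately show ?thesis using measurable_space by auto
  qed
  then have "?A 1 \<inter> (\<Inter>i\<in>{2..d}. S i -` ?A i) = U" by auto
  then have "emeasure \<sigma> (PiE {1..d} ?A) = ennreal \<alpha>" using joint[OF A] mU by simp
  moreover have "emeasure \<sigma> (PiE {1..d} ?A) = 0"
  proof -
    have meas: "PiE {1..d} ?A \<in> sets \<sigma>"
      unfolding sets_\<sigma> Xpow_def using A by (intro sets_PiM_I_finite) auto
    have "AE x in \<sigma>. x \<notin> PiE {1..d} ?A"
      using conc unfolding concentrated_on_def
    proof eventually_elim
      case (elim x)
      then have "x 1 \<in> Z 1" using 1 by (rule PiE_mem)
      then have "x 1 \<notin> ?A 1" by (simp add: U_def)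
      then show ?case using PiE_mem[OF _ 1, of x ?A] by blast
    qed
    then have "AE x in \<sigma>. x \<in> PiE {1..d} ?A \<longleftrightarrow> x \<in> {}" by eventually_elim blast
    then show ?thesis using emeasure_eq_AE[OF _ meas, of "{}"] by simp
  qed
  ultimately show False using \<alpha> by simp
qed

lemma diag_seq_eq:
  assumes d: "d \<ge> 1" and half: "\<forall>i\<in>{1..d}. J n0 i < half n0"
    and J_Suc: "\<And>n. n \<ge> n0 \<Longrightarrow> J (Suc n) = (\<lambda>i. J n i + shift n (\<tau> n i))"
    and digits: "\<And>n. n \<ge> n0 \<Longrightarrow> \<forall>i\<in>{1..d}. \<tau> n i \<in> {1, 2, 3}" and n: "n \<ge> n0"
  shows "(\<forall>i\<in>{1..d}. J n i < half n)
    \<and> diag_seq d n0 (diagonal_of d n0 (J n0)) \<tau> n = diagonal_of d n (J n)"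
  using n
proof (induction n rule: dec_induct)
  case base
  show ?case using half by (cases n0) auto
next
  case (step n)
  then have IH: "\<forall>i\<in>{1..d}. J n i < half n"
    "diag_seq d n0 (diagonal_of d n0 (J n0)) \<tau> n = diagonal_of d n (J n)" by auto
  have "\<forall>i\<in>{1..d}. J (Suc n) i < half (Suc n)"
    unfolding J_Suc[OF step(1)] using half_index[OF IH(1)] shift_lt_half by blast
  moreover have "diag_seq d n0 (diagonal_of d n0 (J n0)) \<tau> (Suc n) = diagonal_of d (Suc n) (J (Suc n))"
    using step(1) next_diagonal_eq[OF d IH(1) digits[OF step(1)]] IH(2) J_Suc[OF step(1)] by simp
  ultimately show ?case by blast
qed

text \<open>The diagonal on which \<open>\<sigma>\<close> is concentrated for large \<open>n\<close> is the only one of positive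
measure, because distinct diagonals are disjoint. Hence it is the value of \<open>D_of\<close>, which the parameters
prescribe.\<close>

lemma is_sigma_diagonal_sequence:
  assumes d: "d \<ge> 1" and par: "(n0, D, \<tau>) \<in> params d" and \<sigma>: "is_sigma d n0 D \<tau> \<sigma>"
  obtains N J where "N \<ge> n0" "diagonal_sequence d \<sigma> N J \<tau>"
proof -
  have "is_diagonal d n0 D" and digits: "\<And>n. n \<ge> n0 \<Longrightarrow> \<forall>i\<in>{1..d}. \<tau> n i \<in> {1, 2, 3}"
    using par by (auto simp: params_def is_initial_def)
  then obtain j where j: "\<forall>i\<in>{1..d}. j i < half n0" "D = diagonal_of d n0 j"
    using is_diagonalE[OF d] by metis
  define J where "J n = (\<lambda>i. j i + (\<Sum>m\<in>{n0..<n}. shift m (\<tau> m i)))" for n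
  have J0: "J n0 = j" by (simp add: J_def)
  have J_Suc: "J (Suc n) = (\<lambda>i. J n i + shift n (\<tau> n i))" if "n \<ge> n0" for n
    using that by (auto simp: J_def fun_eq_iff)
  have seq: "\<forall>i\<in>{1..d}. J n i < half n" "diag_seq d n0 D \<tau> n = diagonal_of d n (J n)" if "n \<ge> n0" for n
    using diag_seq_eq[OF d _ J_Suc digits that] j J0 by auto
  have sets_\<sigma>: "sets \<sigma> = sets (Xpow d)" and bfin: "boundedly_finite d \<sigma>" and pres: "preserves \<sigma> (Tpow d)"
    and D_of: "\<And>n. n \<ge> n0 \<Longrightarrow> D_of d \<sigma> n = diag_seq d n0 D \<tau> n"
    and one: "emeasure \<sigma> (Cpow d n0) = 1"
    using \<sigma> by (auto simp: is_sigma_def diagonal_measure_def)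
  obtain n1 where n1: "\<And>n. n \<ge> n1 \<Longrightarrow> \<exists>D. is_diagonal d n D \<and> concentrated_on (restrict_space \<sigma> (Cpow d n)) (\<Union>D)"
    using \<sigma> unfolding is_sigma_def diagonal_measure_def by blast
  have pos: "emeasure \<sigma> (Cpow d n) > 0" if "n \<ge> n0" for n
  proof -
    have "1 \<le> emeasure \<sigma> (Cpow d n)"
      unfolding one[symmetric] using Cpow_mono[OF that] Cpow_sets sets_\<sigma> by (intro emeasure_mono) auto
    then show ?thesis by (rule less_le_trans[rotated]) simp
  qed
  have conc: "AE x in \<sigma>. x \<in> Cpow d n \<longrightarrow> x \<in> \<Union>(diagonal_of d n (J n))" if n: "n \<ge> n0" "n \<ge> n1" for n
  proof -
    obtain E where E: "is_diagonal d n E" "concentrated_on (restrict_space \<sigma> (Cpow d n)) (\<Union>E)"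
      using n1[OF n(2)] by blast
    obtain e where e: "E = diagonal_of d n e" using is_diagonalE[OF d E(1)] by metis
    have meas: "\<Union>(diagonal_of d n e) \<in> sets \<sigma>" for e
      unfolding sets_\<sigma> by (rule diagonal_sets)
    have AE: "AE x in \<sigma>. x \<in> Cpow d n \<longrightarrow> x \<in> \<Union>E"
    proof -
      have "Cpow d n \<inter> space \<sigma> \<in> sets \<sigma>" using Cpow_sets[of d n] sets_\<sigma> by auto
      then show ?thesis using E(2) unfolding concentrated_on_def by (simp add: AE_restrict_space_iff)
    qed
    have "emeasure \<sigma> (Cpow d n) \<le> emeasure \<sigma> (\<Union>E)"
      using AE meas unfolding e by (intro emeasure_mono_AE) auto
    then have pE: "emeasure \<sigma> (\<Union>E) > 0" using pos[OF n(1)] by (rule less_le_trans[rotated])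
    have "D_of d \<sigma> n = E"
      unfolding D_of_def
    proof (rule the_equality)
      fix E' assume E': "is_diagonal d n E' \<and> emeasure \<sigma> (\<Union>E') > 0"
      obtain e' where e': "E' = diagonal_of d n e'" using is_diagonalE[OF d conjunct1[OF E']] by metis
      show "E' = E"
      proof (rule ccontr)
        assume "E' \<noteq> E"
        then have "\<Union>E' \<inter> \<Union>E = {}" using diagonal_eq_if_meet[of _ d n e' e] unfolding e e' by blast
        moreover have "\<Union>E' \<subseteq> Cpow d n" unfolding e' by (rule diagonal_subset_Cpow)
        ultimately have "AE x in \<sigma>. x \<in> \<Union>E' \<longleftrightarrow> x \<in> {}" using AE by (elim eventually_mono) blast
        then have "emeasure \<sigma> (\<Union>E') = 0" using emeasure_eq_AE[of "\<Union>E'" "{}" \<sigma>] meas[of e'] unfolding e' by simp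
        then show False using E' by simp
      qed
    qed (use E(1) pE in blast)
    then have "diagonal_of d n (J n) = E" using D_of[OF n(1)] seq(2)[OF n(1)] by simp
    then show ?thesis using AE by simp
  qed
  have "diagonal_sequence d \<sigma> (max n0 n1) J \<tau>"
    by unfold_locales (use d sets_\<sigma> bfin pres seq J_Suc digits conc pos in auto)
  then show ?thesis using that[of "max n0 n1"] by simp
qed

section \<open>Normalised counting measure on an orbit\<close>

lemma Tpow_inj: "inj_on (Tpow d) (space (Xpow d))"
proof (rule inj_onI)
  fix x y assume xy: "x \<in> space (Xpow d)" "y \<in> space (Xpow d)" "Tpow d x = Tpow d y"
  have "x i = y i" if i: "i \<in> {1..d}" for i
  proof -
    have "T (x i) = T (y i)" using fun_cong[OF xy(3), of i] i by (simp add: Tpow_def)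
    moreover have "x i \<ge> 0" "y i \<ge> 0" using xy(1,2) i by (auto simp: mem_space_Xpow)
    ultimately show ?thesis using T_inj by blast
  qed
  then show "x = y" using xy(1,2) unfolding mem_space_Xpow by (auto intro: extensionalityI)
qed

lemma Tpow_pow_space: "x \<in> space (Xpow d) \<Longrightarrow> (Tpow d ^^ k) x \<in> space (Xpow d)"
  by (induction k) (auto intro: Tpow_space)

lemma Tpow_pow_inj:
  assumes "x \<in> space (Xpow d)" "y \<in> space (Xpow d)" "(Tpow d ^^ k) x = (Tpow d ^^ k) y"
  shows "x = y"
  using assms(3) by (induction k) (use assms(1,2) in \<open>auto dest: inj_onD[OF Tpow_inj] intro: Tpow_pow_space\<close>)

lemma Tpow_measurable: "Tpow d \<in> measurable (Xpow d) (Xpow d)"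
proof -
  have "(\<lambda>x. T (x i)) \<in> measurable (Xpow d) mu" if "i \<in> {1..d}" for i
    unfolding Xpow_def
    by (rule measurable_compose[OF measurable_component_singleton[OF that, of "\<lambda>_. mu"] T_measurable])
  then have "(\<lambda>x. \<lambda>i\<in>{1..d}. T (x i)) \<in> measurable (Xpow d) (PiM {1..d} (\<lambda>_. mu))"
    by (rule measurable_restrict)
  then show ?thesis unfolding Tpow_def[abs_def] Xpow_def .
qed

text \<open>
  A point all of whose steps are corner cases from \<open>N\<close> on. The assumption \<open>deep\<close> says that its indices
  move away from both ends of the lower half of the tower; it provides the whole two-sided orbit, and
  any finite part of this orbit stays on the diagonal of the point in all large towers.
\<close>

locale corner_orbit =
  fixes d :: nat and N :: nat and p \<tau> :: "nat \<Rightarrow> nat \<Rightarrow> nat" and x :: "nat \<Rightarrow> real"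
  assumes d: "d \<ge> 1"
    and p_half: "\<And>n. n \<ge> N \<Longrightarrow> \<forall>i\<in>{1..d}. p n i < half n"
    and p_Suc: "\<And>n. n \<ge> N \<Longrightarrow> p (Suc n) = (\<lambda>i. p n i + shift n (\<tau> n i))"
    and digits: "\<And>n. n \<ge> N \<Longrightarrow> \<forall>i\<in>{1..d}. \<tau> n i \<in> {1, 2, 3}"
    and corner: "\<And>n. n \<ge> N \<Longrightarrow> corner_case d (\<tau> n)"
    and x_cell: "\<And>n. n \<ge> N \<Longrightarrow> x \<in> cell d n (p n)"
    and deep: "\<And>k. \<exists>m. \<forall>n\<ge>m. \<forall>i\<in>{1..d}. k \<le> p n i \<and> p n i + k < half n"
begin

lemma deepE:
  obtains n where "n \<ge> m" "n \<ge> N" "\<forall>i\<in>{1..d}. k \<le> p n i \<and> p n i + k < half n"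
proof -
  obtain m0 where m0: "\<forall>n\<ge>m0. \<forall>i\<in>{1..d}. k \<le> p n i \<and> p n i + k < half n" using deep by metis
  show ?thesis by (rule that[of "max m0 (max m N)"]) (use m0 in auto)
qed

lemma x_space: "x \<in> space (Xpow d)"
  using x_cell[OF order_refl] cell_subset_space[OF half_index[OF p_half[OF order_refl]]] by blast

lemma backward: "\<exists>y. y \<in> space (Xpow d) \<and> (Tpow d ^^ k) y = x"
proof -
  obtain n where n: "n \<ge> N" "\<forall>i\<in>{1..d}. k \<le> p n i \<and> p n i + k < half n" using deepE by metis
  have h: "\<forall>i\<in>{1..d}. p n i - k + k < height n" using n(2) half_index[OF p_half[OF n(1)]] by simp
  have "cell d n (\<lambda>i. p n i - k + k) = cell d n (p n)" using n(2) by (intro cell_cong) simp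
  then have "x \<in> (Tpow d ^^ k) ` cell d n (\<lambda>i. p n i - k)"
    using Tpow_pow_image_cell[OF h] x_cell[OF n(1)] by simp
  then obtain y where y: "y \<in> cell d n (\<lambda>i. p n i - k)" "(Tpow d ^^ k) y = x" by blast
  have "\<forall>i\<in>{1..d}. p n i - k < height n" using h by auto
  from cell_subset_space[OF this] show ?thesis using y by blast
qed

definition orb :: "int \<Rightarrow> nat \<Rightarrow> real" where
  "orb k = (if k \<ge> 0 then (Tpow d ^^ nat k) x
     else (SOME y. y \<in> space (Xpow d) \<and> (Tpow d ^^ nat (- k)) y = x))"

lemma orb_0: "orb 0 = x"
  by (simp add: orb_def)

lemma orb_nonpos:
  assumes "k \<le> 0"
  shows "orb k \<in> space (Xpow d) \<and> (Tpow d ^^ nat (- k)) (orb k) = x"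
proof (cases "k = 0")
  case True
  then show ?thesis using x_space by (simp add: orb_def)
next
  case False
  then have "orb k = (SOME y. y \<in> space (Xpow d) \<and> (Tpow d ^^ nat (- k)) y = x)"
    using assms by (simp add: orb_def)
  then show ?thesis using someI_ex[OF backward[of "nat (- k)"]] by simp
qed

lemma orb_space: "orb k \<in> space (Xpow d)"
  using orb_nonpos[of k] Tpow_pow_space[OF x_space] by (cases "k \<ge> 0") (auto simp: orb_def)

lemma Tpow_orb: "Tpow d (orb k) = orb (k + 1)"
proof (cases "k \<ge> 0")
  case True
  then have "nat (k + 1) = Suc (nat k)" by simp
  then show ?thesis using True by (simp add: orb_def)
next
  case False
  then have e: "nat (- k) = Suc (nat (- (k + 1)))" by simp
  have "(Tpow d ^^ nat (- (k + 1))) (Tpow d (orb k)) = (Tpow d ^^ nat (- k)) (orb k)"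
    unfolding e by (simp only: funpow_Suc_right comp_def)
  also have "\<dots> = (Tpow d ^^ nat (- (k + 1))) (orb (k + 1))"
    using orb_nonpos[of k] orb_nonpos[of "k + 1"] False by simp
  finally show ?thesis by (rule Tpow_pow_inj[OF Tpow_space[OF orb_space] orb_space])
qed

lemma orb_cell:
  assumes n: "n \<ge> N" and q: "\<forall>i\<in>{1..d}. q i < height n" "\<forall>i\<in>{1..d}. int (q i) = int (p n i) + k"
  shows "orb k \<in> cell d n q"
proof (cases "k \<ge> 0")
  case True
  have e: "q i = p n i + nat k" if "i \<in> {1..d}" for i using q(2)[rule_format, OF that] True by linarith
  then have "\<forall>i\<in>{1..d}. p n i + nat k < height n" using q(1) by simp
  then have "(Tpow d ^^ nat k) x \<in> cell d n (\<lambda>i. p n i + nat k)"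
    using Tpow_pow_cell_iff[OF x_space] x_cell[OF n] by blast
  moreover have "cell d n (\<lambda>i. p n i + nat k) = cell d n q" using e by (intro cell_cong) simp
  ultimately show ?thesis using True by (simp add: orb_def)
next
  case False
  have e: "p n i = q i + nat (- k)" if "i \<in> {1..d}" for i using q(2)[rule_format, OF that] False by linarith
  then have h: "\<forall>i\<in>{1..d}. q i + nat (- k) < height n" using half_index[OF p_half[OF n]] by simp
  have "cell d n (p n) = cell d n (\<lambda>i. q i + nat (- k))" using e by (rule cell_cong)
  then have "(Tpow d ^^ nat (- k)) (orb k) \<in> cell d n (\<lambda>i. q i + nat (- k))"
    using orb_nonpos[of k] False x_cell[OF n] by simp
  then show ?thesis using Tpow_pow_cell_iff[OF orb_space h] by blast
qed

lemma orb_deep: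
  assumes "n \<ge> N" "\<forall>i\<in>{1..d}. nat \<bar>k\<bar> \<le> p n i \<and> p n i + nat \<bar>k\<bar> < half n"
  obtains q where "orb k \<in> cell d n q" "\<forall>i\<in>{1..d}. q i < half n" "\<forall>i\<in>{1..d}. int (q i) = int (p n i) + k"
proof -
  define q where "q i = nat (int (p n i) + k)" for i
  have q: "\<forall>i\<in>{1..d}. int (q i) = int (p n i) + k \<and> q i < half n"
  proof
    fix i assume "i \<in> {1..d}"
    then show "int (q i) = int (p n i) + k \<and> q i < half n" using assms(2) unfolding q_def by force
  qed
  moreover have "orb k \<in> cell d n q" using q half_index[of "{1..d}" q n] by (intro orb_cell[OF assms(1)]) auto
  ultimately show ?thesis using that by blast
qed

text \<open>The orbit may leave \<open>C_n^d\<close>, so a return to it could lie on another diagonal. In a tower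
\<open>m\<close> that is large compared with \<open>k\<close> there has been no excursion yet, and \<open>corner_descend\<close> transfers the
offset \<open>k\<close> from \<open>m\<close> down to \<open>n\<close>: a return never happens.\<close>

lemma orb_in_Cpow:
  assumes n: "n \<ge> N" and C: "orb k \<in> Cpow d n"
  obtains q where "orb k \<in> cell d n q" "\<forall>i\<in>{1..d}. q i < half n" "\<forall>i\<in>{1..d}. int (q i) = int (p n i) + k"
proof -
  obtain m where m: "m \<ge> n" "m \<ge> N" "\<forall>i\<in>{1..d}. nat \<bar>k\<bar> \<le> p m i \<and> p m i + nat \<bar>k\<bar> < half m"
    using deepE by metis
  have "\<exists>q. orb k \<in> cell d n q \<and> (\<forall>i\<in>{1..d}. q i < half n) \<and> (\<forall>i\<in>{1..d}. int (q i) = int (p n i) + k)"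
    using m(1)
  proof (induction n rule: inc_induct)
    case base
    show ?case using orb_deep[OF m(2,3)] by metis
  next
    case (step l)
    then have l: "l \<ge> N" using n by simp
    have "orb k \<in> Cpow d l" using C Cpow_mono[OF step(1)] by blast
    obtain q where q: "orb k \<in> cell d (Suc l) q" "\<forall>i\<in>{1..d}. q i < half (Suc l)"
      "\<forall>i\<in>{1..d}. int (q i) = int (p l i + shift l (\<tau> l i)) + k"
      using step.IH unfolding p_Suc[OF l] by blast
    show ?case
      using corner_descend[OF corner[OF l] p_half[OF l] digits[OF l] \<open>orb k \<in> Cpow d l\<close> q] by metis
  qed
  then show ?thesis using that by blast
qed

lemma orb_in_Cpow_finite: "finite {k. orb k \<in> Cpow d n}"
proof -
  have 1: "1 \<in> {1..d}" using d by (simp add: atLeastAtMost_iff)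
  let ?n = "max n N"
  have "{k. orb k \<in> Cpow d n} \<subseteq> {- int (p ?n 1)..int (half ?n)}"
  proof
    fix k assume "k \<in> {k. orb k \<in> Cpow d n}"
    then have "orb k \<in> Cpow d ?n" using Cpow_mono[of n ?n] by auto
    then obtain q where "\<forall>i\<in>{1..d}. q i < half ?n" "\<forall>i\<in>{1..d}. int (q i) = int (p ?n i) + k"
      using orb_in_Cpow[of ?n k] by (metis max.cobounded2)
    then show "k \<in> {- int (p ?n 1)..int (half ?n)}" using 1 by (force simp: atLeastAtMost_iff)
  qed
  then show ?thesis by (rule finite_subset) simp
qed

lemma orb_diagonal:
  assumes "n \<ge> N" "orb k \<in> Cpow d n"
  shows "orb k \<in> \<Union>(diagonal_of d n (p n))"
proof -
  obtain q where q: "orb k \<in> cell d n q" "\<forall>i\<in>{1..d}. q i < half n"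
    "\<forall>i\<in>{1..d}. int (q i) = int (p n i) + k" by (rule orb_in_Cpow[OF assms])
  show ?thesis unfolding mem_diagonal[OF q(1,2)] using q(3) by blast
qed

definition visits :: nat where
  "visits = card {k. orb k \<in> Cpow d N}"

lemma x_Cpow: "n \<ge> N \<Longrightarrow> x \<in> Cpow d n"
  using CpowI x_cell p_half by blast

lemma visits_pos: "visits > 0"
proof -
  have "0 \<in> {k. orb k \<in> Cpow d N}" using x_Cpow orb_0 by simp
  then show ?thesis unfolding visits_def using orb_in_Cpow_finite[of N] card_gt_0_iff by blast
qed

text \<open>Dividing by the finite number of visits to \<open>C_N^d\<close> gives this set mass \<open>1\<close>.\<close>

definition orbit_measure :: "(nat \<Rightarrow> real) measure" where
  "orbit_measure = scale_measure (ennreal (1 / real visits)) (distr (count_space UNIV) (Xpow d) orb)"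

lemma sets_orbit_measure: "sets orbit_measure = sets (Xpow d)"
  by (simp add: orbit_measure_def)

lemma space_orbit_measure: "space orbit_measure = space (Xpow d)"
  using sets_orbit_measure by (rule sets_eq_imp_space_eq)

lemma orb_measurable: "orb \<in> measurable (count_space UNIV) (Xpow d)"
  using orb_space by simp

lemma emeasure_orbit_measure:
  assumes "A \<in> sets (Xpow d)"
  shows "emeasure orbit_measure A = ennreal (1 / real visits) * emeasure (count_space UNIV) {k. orb k \<in> A}"
  unfolding orbit_measure_def using emeasure_distr[OF orb_measurable assms] by (simp add: vimage_def)

lemma orbit_measure_pos_iff:
  assumes "A \<in> sets (Xpow d)"
  shows "emeasure orbit_measure A > 0 \<longleftrightarrow> (\<exists>k. orb k \<in> A)"
proof -
  have "emeasure (count_space UNIV) {k. orb k \<in> A} = 0 \<longleftrightarrow> {k. orb k \<in> A} = {}"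
    by (simp only: emeasure_count_space_eq_0 subset_UNIV simp_thms)
  moreover have "ennreal (1 / real visits) \<noteq> 0" using visits_pos by (simp add: ennreal_eq_0_iff)
  ultimately have "emeasure orbit_measure A = 0 \<longleftrightarrow> {k. orb k \<in> A} = {}"
    unfolding emeasure_orbit_measure[OF assms] mult_eq_0_iff by blast
  then show ?thesis unfolding zero_less_iff_neq_zero by blast
qed

lemma orbit_measure_finite:
  assumes "A \<in> sets (Xpow d)" "finite {k. orb k \<in> A}"
  shows "emeasure orbit_measure A < \<infinity>"
  unfolding emeasure_orbit_measure[OF assms(1)] using assms(2)
  by (simp add: emeasure_count_space_finite ennreal_mult_less_top ennreal_of_nat_eq_real_of_nat)

lemma orbit_measure_normalised: "emeasure orbit_measure (Cpow d N) = 1"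
proof -
  have "emeasure (count_space UNIV) {k. orb k \<in> Cpow d N} = ennreal (real visits)"
    unfolding visits_def using orb_in_Cpow_finite[of N]
    by (simp add: emeasure_count_space_finite ennreal_of_nat_eq_real_of_nat)
  then show ?thesis
    unfolding emeasure_orbit_measure[OF Cpow_sets] using visits_pos by (simp add: ennreal_mult[symmetric])
qed

lemma orbit_measure_bounded: "boundedly_finite d orbit_measure"
  unfolding boundedly_finite_def
proof (intro ballI impI)
  fix A assume A: "A \<in> sets (Xpow d)" and "\<exists>r. \<forall>x\<in>A. \<forall>i\<in>{1..d}. x i \<le> r"
  then obtain r where r: "\<forall>x\<in>A. \<forall>i\<in>{1..d}. x i \<le> r" by blast
  obtain n where n: "{0..r} \<subseteq> C n" using C_exhausts[of 0 r] by metis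
  have "A \<subseteq> Cpow d n"
  proof
    fix y assume y: "y \<in> A"
    then have s: "y \<in> space (Xpow d)" using A sets.sets_into_space by blast
    have "y i \<in> C n" if i: "i \<in> {1..d}" for i
    proof -
      have "y i \<in> {0..r}" using r s y i unfolding mem_space_Xpow by (simp add: atLeastAtMost_iff)
      then show ?thesis using n by blast
    qed
    then show "y \<in> Cpow d n" using s unfolding Cpow_def PiE_iff mem_space_Xpow by blast
  qed
  then have "finite {k. orb k \<in> A}" by (intro finite_subset[OF _ orb_in_Cpow_finite[of n]]) auto
  then show "emeasure orbit_measure A < \<infinity>" by (rule orbit_measure_finite[OF A])
qed

lemma orbit_measure_preserved: "preserves orbit_measure (Tpow d)"
  unfolding preserves_def
proof (intro conjI ballI)
  show "Tpow d \<in> measurable orbit_measure orbit_measure"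
    using Tpow_measurable measurable_cong_sets[OF sets_orbit_measure sets_orbit_measure] by blast
  fix A assume "A \<in> sets orbit_measure"
  then have A: "A \<in> sets (Xpow d)" by (simp add: sets_orbit_measure)
  have B: "Tpow d -` A \<inter> space (Xpow d) \<in> sets (Xpow d)" using Tpow_measurable A by (rule measurable_sets)
  have "bij_betw (\<lambda>k. k + 1) {k. orb k \<in> Tpow d -` A \<inter> space (Xpow d)} {k. orb k \<in> A}"
    by (rule bij_betw_byWitness[of _ "\<lambda>k. k - 1"]) (use Tpow_orb orb_space in auto)
  then have "emeasure (count_space UNIV) {k. orb k \<in> Tpow d -` A \<inter> space (Xpow d)}
      = emeasure (count_space UNIV) {k. orb k \<in> A}"
    using bij_betw_same_card[of "\<lambda>k. k + 1" "{k. orb k \<in> Tpow d -` A \<inter> space (Xpow d)}" "{k. orb k \<in> A}"]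
      bij_betw_finite[of "\<lambda>k. k + 1" "{k. orb k \<in> Tpow d -` A \<inter> space (Xpow d)}" "{k. orb k \<in> A}"]
    by (simp only: emeasure_count_space subset_UNIV simp_thms if_True)
  then show "emeasure orbit_measure (Tpow d -` A \<inter> space orbit_measure) = emeasure orbit_measure A"
    unfolding space_orbit_measure emeasure_orbit_measure[OF A] emeasure_orbit_measure[OF B] by simp
qed

lemma orbit_measure_concentrated:
  assumes n: "n \<ge> N"
  shows "concentrated_on (restrict_space orbit_measure (Cpow d n)) (\<Union>(diagonal_of d n (p n)))"
proof -
  let ?A = "Cpow d n - \<Union>(diagonal_of d n (p n))"
  have A: "?A \<in> sets (Xpow d)" using Cpow_sets diagonal_sets by blast
  have "\<not> emeasure orbit_measure ?A > 0" unfolding orbit_measure_pos_iff[OF A] using orb_diagonal[OF n] by blast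
  then have "AE y in orbit_measure. y \<in> Cpow d n \<longrightarrow> y \<in> \<Union>(diagonal_of d n (p n))"
    by (intro AE_I[of _ _ ?A]) (use A sets_orbit_measure in auto)
  moreover have "Cpow d n \<inter> space orbit_measure \<in> sets orbit_measure"
    using Cpow_sets[of d n] sets_orbit_measure by auto
  ultimately show ?thesis unfolding concentrated_on_def by (simp add: AE_restrict_space_iff)
qed

lemma orbit_diagonal_unique:
  assumes n: "n \<ge> N"
  shows "is_diagonal d n E \<and> emeasure orbit_measure (\<Union>E) > 0 \<longleftrightarrow> E = diagonal_of d n (p n)"
proof
  assume E: "is_diagonal d n E \<and> emeasure orbit_measure (\<Union>E) > 0"
  obtain e where e: "E = diagonal_of d n e" using is_diagonalE[OF d conjunct1[OF E]] by metis
  have "emeasure orbit_measure (\<Union>(diagonal_of d n e)) > 0" using E e by simp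
  then obtain k where k: "orb k \<in> \<Union>(diagonal_of d n e)"
    unfolding orbit_measure_pos_iff[OF diagonal_sets] by (rule exE)
  have "orb k \<in> \<Union>(diagonal_of d n (p n))"
    by (rule orb_diagonal[OF n subsetD[OF diagonal_subset_Cpow k]])
  then show "E = diagonal_of d n (p n)" unfolding e by (rule diagonal_eq_if_meet[OF k])
next
  assume E: "E = diagonal_of d n (p n)"
  have "orb 0 \<in> \<Union>(diagonal_of d n (p n))" 
    by (rule orb_diagonal[OF n]) (simp add: orb_0 x_Cpow[OF n])
  then have "emeasure orbit_measure (\<Union>E) > 0" unfolding E orbit_measure_pos_iff[OF diagonal_sets] by (rule exI)
  then show "is_diagonal d n E \<and> emeasure orbit_measure (\<Union>E) > 0"
    using is_diagonal_diagonal_of[OF d p_half[OF n]] E by simp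
qed

lemma orbit_measure_diagonal: "diagonal_measure d orbit_measure"
  unfolding diagonal_measure_def
proof (intro conjI sets_orbit_measure orbit_measure_bounded orbit_measure_preserved exI allI impI)
  fix n assume "n \<ge> N"
  then show "concentrated_on (restrict_space orbit_measure (Cpow d n)) (\<Union>(diagonal_of d n (p n)))"
    "is_diagonal d n (diagonal_of d n (p n))"
    using orbit_measure_concentrated is_diagonal_diagonal_of[OF d p_half] by auto
qed

lemma orbit_measure_is_sigma:
  assumes "x \<in> Cpow d (N - 1)"
  shows "is_sigma d N (diagonal_of d N (p N)) \<tau> orbit_measure"
  unfolding is_sigma_def
proof (intro conjI orbit_measure_diagonal orbit_measure_normalised allI impI)
  have "orb 0 \<in> Cpow d (N - 1)" using assms orb_0 by simp
  then have "\<exists>k. orb k \<in> Cpow d (N - 1)" by (rule exI)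
  then have "emeasure orbit_measure (Cpow d (N - 1)) > 0" unfolding orbit_measure_pos_iff[OF Cpow_sets] .
  moreover have "\<forall>n\<ge>N. \<exists>!D. is_diagonal d n D \<and> emeasure orbit_measure (\<Union>D) > 0"
    using orbit_diagonal_unique by simp
  ultimately show "n0_of d orbit_measure \<le> N" unfolding n0_of_def by (intro Least_le) blast
  fix n assume n: "n \<ge> N"
  have "D_of d orbit_measure n = diagonal_of d n (p n)" unfolding D_of_def orbit_diagonal_unique[OF n] by simp
  then show "D_of d orbit_measure n = diag_seq d N (diagonal_of d N (p N)) \<tau> n"
    using diag_seq_eq[OF d p_half[OF order_refl] p_Suc digits n] by simp
qed

end

section \<open>An orbit with only corner cases\<close>

text \<open>The digit sequences of \<open>1/4 = 0.0202...\<close> (first coordinate) and \<open>3/4 = 0.2020...\<close> (all other coordinates)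
in base three, increased by one. The two have opposite digits at every place, so
every step is a corner case.\<close>

definition alt_digit :: "nat \<Rightarrow> nat \<Rightarrow> nat" where
  "alt_digit n i = (if even n = (i = 1) then 1 else 3)"

definition alt_index :: "nat \<Rightarrow> nat \<Rightarrow> nat" where
  "alt_index n i = (\<Sum>m<n. shift m (alt_digit m i))"

definition alt_point :: "nat \<Rightarrow> nat \<Rightarrow> real" where
  "alt_point d = (\<lambda>i\<in>{1..d}. if i = 1 then 1 / 4 else 3 / 4)"

lemma alt_index_Suc: "alt_index (Suc n) = (\<lambda>i. alt_index n i + shift n (alt_digit n i))"
  by (simp add: alt_index_def fun_eq_iff)

lemma alt_digit_range: "alt_digit n i \<in> {1, 2, 3}"
  by (simp add: alt_digit_def)

lemma alt_index_height: "alt_index n i < height n"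
proof (induction n)
  case (Suc n)
  then show ?case unfolding alt_index_Suc by (rule shift_lt_height)
qed (simp add: alt_index_def height_0)

lemma alt_index_half: "n \<ge> 1 \<Longrightarrow> alt_index n i < half n"
  using shift_lt_half[OF alt_index_height] by (cases n) (auto simp: alt_index_Suc)

text \<open>The relative position of the point in its level alternates between \<open>1/4\<close> and \<open>3/4\<close>: dividing the
level into thirds maps \<open>1/4\<close> to \<open>3 * 1/4\<close> and \<open>3/4\<close> to \<open>3 * 3/4 - 2\<close>.\<close>

lemma alt_tower:
  "tower n ! alt_index n i = (if i = 1 then 1 / 4 else 3 / 4) - (if alt_digit n i = 1 then 1 / 4 else 3 / 4) / 3 ^ n"
proof (induction n)
  case 0
  then show ?case by (simp add: alt_index_def alt_digit_def)
next
  case (Suc n)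
  define w :: real where "w = 1 / 3 ^ Suc n"
  have w: "c / 3 ^ n = 3 * c * w" "c / 3 ^ Suc n = c * w" for c by (simp_all add: w_def)
  have step: "tower (Suc n) ! alt_index (Suc n) i = tower n ! alt_index n i + (real (alt_digit n i) - 1) / 3 ^ Suc n"
    unfolding alt_index_Suc by (rule tower_Suc_nth[OF alt_index_height alt_digit_range])
  have "alt_digit n i = 1 \<and> alt_digit (Suc n) i = 3 \<or> alt_digit n i = 3 \<and> alt_digit (Suc n) i = 1"
    by (auto simp: alt_digit_def)
  then show ?case unfolding step Suc w by (elim disjE conjE) simp_all
qed

lemma alt_cell: "alt_point d \<in> cell d n (alt_index n)"
  unfolding mem_cell alt_point_def level_def alt_tower by (auto simp: field_simps)

lemma n_le_height: "n \<le> height n"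
  by (induction n) (auto simp: height_Suc)

lemma alt_deep:
  assumes "n \<ge> 2 * k + 4"
  shows "k \<le> alt_index n i \<and> alt_index n i + k < half n"
proof -
  define m where "m = n - 2"
  have m: "n = Suc (Suc m)" using assms unfolding m_def by linarith
  have "alt_index n i \<ge> height m"
    unfolding m alt_index_Suc by (auto simp: alt_digit_def shift_def height_Suc)
  then have "k \<le> alt_index n i" using n_le_height[of m] assms m by linarith
  moreover have "alt_index n i + k < half n"
  proof -
    have "alt_index (Suc m) i < half (Suc m)" by (rule alt_index_half) simp
    then have "2 * alt_index (Suc m) i < height (Suc m)" by linarith
    moreover have "alt_index n i = alt_index (Suc m) i + shift (Suc m) (alt_digit (Suc m) i)"
      unfolding m alt_index_Suc[of "Suc m"] ..
    moreover have "half n = 3 * height (Suc m) + 1" unfolding m by (rule half_Suc)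
    moreover have "shift (Suc m) (alt_digit (Suc m) i) \<le> 2 * height (Suc m) + 1" by (simp add: shift_def)
    moreover have "Suc m \<le> height (Suc m)" by (rule n_le_height)
    ultimately show ?thesis using assms m by linarith
  qed
  ultimately show ?thesis ..
qed

lemma alt_corner:
  assumes "d \<ge> 2"
  shows "corner_case d (alt_digit n)"
proof -
  have "1 \<in> {1..d}" "2 \<in> {1..d}" using assms by (auto simp: atLeastAtMost_iff)
  then have "{alt_digit n 1, alt_digit n 2} \<subseteq> alt_digit n ` {1..d}" by blast
  moreover have "{alt_digit n 1, alt_digit n 2} = {1, 3}" by (auto simp: alt_digit_def)
  ultimately show ?thesis unfolding corner_case_def by metis
qed

lemma alt_orbit:
  assumes "d \<ge> 2"
  shows "corner_orbit d 2 alt_index alt_digit (alt_point d)"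
proof
  show "\<exists>m. \<forall>n\<ge>m. \<forall>i\<in>{1..d}. k \<le> alt_index n i \<and> alt_index n i + k < half n" for k
    by (rule exI[of _ "2 * k + 4"]) (use alt_deep in blast)
qed (use assms alt_index_half alt_index_Suc alt_digit_range alt_corner alt_cell in auto)

text \<open>Since \<open>C_0\<close> is empty, a \<open>2\<close>-diagonal is initial as soon as it meets some \<open>1\<close>-diagonal. The point itself
witnesses that the two diagonals meet.\<close>

lemma alt_params:
  assumes d: "d \<ge> 2"
  shows "(2, diagonal_of d 2 (alt_index 2), alt_digit) \<in> params d"
proof -
  let ?D = "diagonal_of d 2 (alt_index 2)"
  have half: "\<forall>i\<in>{1..d}. alt_index n i < half n" if "n \<ge> 1" for n using alt_index_half that by blast
  have diag: "is_diagonal d n (diagonal_of d n (alt_index n))" "alt_point d \<in> \<Union>(diagonal_of d n (alt_index n))"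
    if "n \<ge> 1" for n
  proof -
    show "is_diagonal d n (diagonal_of d n (alt_index n))"
      by (rule is_diagonal_diagonal_of[OF _ half[OF that]]) (use d in simp)
    show "alt_point d \<in> \<Union>(diagonal_of d n (alt_index n))"
      unfolding mem_diagonal[OF alt_cell half[OF that]] by (intro exI[of _ 0]) simp
  qed
  let ?P = "\<lambda>E. is_diagonal d (2 - 1) E \<and> \<Union>E \<inter> \<Union>?D \<noteq> {}"
  have E: "?P (diagonal_of d 1 (alt_index 1))" using diag[of 1] diag[of 2] by auto
  have "Cpow d (2 - 2) = {}"
    unfolding Cpow_def PiE_eq_empty_iff C_def using d by (auto simp: height_0 atLeastAtMost_iff intro: exI[of _ 1])
  moreover have "(\<exists>E F. E \<noteq> F \<and> is_diagonal d (2 - 1) E \<and> \<Union>E \<inter> \<Union>?D \<noteq> {}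
      \<and> is_diagonal d (2 - 1) F \<and> \<Union>F \<inter> \<Union>?D \<noteq> {}) \<or> (\<exists>!E. ?P E)"
    using E by metis
  ultimately have "is_initial d 2 ?D"
    unfolding is_initial_def using diag(1)[of 2] by simp
  moreover have "infinite {n. n \<ge> 2 \<and> alt_digit n i \<in> {1, 2}}" for i
    unfolding infinite_nat_iff_unbounded_le
  proof
    fix m
    show "\<exists>n\<ge>m. n \<in> {n. n \<ge> 2 \<and> alt_digit n i \<in> {1, 2}}"
      by (rule exI[of _ "2 * m + 2 + (if i = 1 then 0 else 1)"]) (auto simp: alt_digit_def)
  qed
  ultimately show ?thesis using alt_digit_range alt_corner[OF d] by (auto simp: params_def)
qed

section \<open>Diagonal measures that are not graph joinings\<close>

lemma sigma_properties:
  assumes d: "d \<ge> 1" and par: "(n0, D, \<tau>) \<in> params d"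
    and corner: "infinite {n. n \<ge> n0 \<and> corner_case d (\<tau> n)}" and \<sigma>: "is_sigma d n0 D \<tau> \<sigma>"
  shows "ergodic \<sigma> (Tpow d)" "\<not> graph_joining d \<sigma>"
    "\<exists>Z. (\<forall>i\<in>{1..d}. Z i \<in> null_sets mu) \<and> concentrated_on \<sigma> (PiE {1..d} Z)"
    "infinite {n. n \<ge> n0 \<and> central_case d (\<tau> n)} \<Longrightarrow> conservative \<sigma> (Tpow d)"
proof -
  obtain N J where N: "N \<ge> n0" and seq: "diagonal_sequence d \<sigma> N J \<tau>"
    using is_sigma_diagonal_sequence[OF d par \<sigma>] by metis
  interpret diagonal_sequence d \<sigma> N J \<tau> by (rule seq)
  have inf: "infinite {n. n \<ge> N \<and> P n}" if "infinite {n. n \<ge> n0 \<and> P n}" for P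
    by (rule infinite_super[OF _ infinite_ge[OF that, of N]]) blast
  show "ergodic \<sigma> (Tpow d)" by (rule ergodic)
  show Z: "\<exists>Z. (\<forall>i\<in>{1..d}. Z i \<in> null_sets mu) \<and> concentrated_on \<sigma> (PiE {1..d} Z)"
    by (rule concentrated_null[OF inf[OF corner]])
  then show "\<not> graph_joining d \<sigma>" using not_graph_joining[OF d] by blast
  show "conservative \<sigma> (Tpow d)" if "infinite {n. n \<ge> n0 \<and> central_case d (\<tau> n)}"
    by (rule conservative[OF inf[OF that]])
qed

theorem mainTheorem6:
  fixes d :: nat
  assumes "d \<ge> 2"
  shows "(\<exists>\<sigma>. diagonal_measure d \<sigma> \<and> emeasure \<sigma> (space \<sigma>) \<noteq> 0
              \<and> ergodic \<sigma> (Tpow d) \<and> \<not> graph_joining d \<sigma>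
              \<and> (\<exists>n0 D \<tau>. (n0, D, \<tau>) \<in> params d \<and> infinite {n. n \<ge> n0 \<and> corner_case d (\<tau> n)}
                            \<and> is_sigma d n0 D \<tau> \<sigma>))
    \<and> (\<forall>n0 D \<tau> \<sigma>. (n0, D, \<tau>) \<in> params d \<longrightarrow>
          infinite {n. n \<ge> n0 \<and> corner_case d (\<tau> n)} \<longrightarrow>
          is_sigma d n0 D \<tau> \<sigma> \<longrightarrow>
            ergodic \<sigma> (Tpow d)
          \<and> \<not> graph_joining d \<sigma>
          \<and> (\<exists>N. (\<forall>i\<in>{1..d}. N i \<in> null_sets mu) \<and> concentrated_on \<sigma> (PiE {1..d} N))
          \<and> (infinite {n. n \<ge> n0 \<and> central_case d (\<tau> n)} \<longrightarrow> conservative \<sigma> (Tpow d)))"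
proof
  have d: "d \<ge> 1" using assms by simp
  interpret corner_orbit d 2 alt_index alt_digit "alt_point d" by (rule alt_orbit[OF assms])
  let ?D = "diagonal_of d 2 (alt_index 2)"
  have "alt_point d \<in> Cpow d (2 - 1)" using CpowI[OF alt_cell[of d 1]] alt_index_half by simp
  then have sigma: "is_sigma d 2 ?D alt_digit orbit_measure" by (rule orbit_measure_is_sigma)
  have inf: "infinite {n. n \<ge> 2 \<and> corner_case d (alt_digit n)}"
    using alt_corner[OF assms] infinite_Ici[of "2 :: nat"] by (simp add: atLeast_def)
  have "emeasure orbit_measure (space orbit_measure) > 0"
    unfolding space_orbit_measure using orbit_measure_pos_iff[of "space (Xpow d)"] orb_space by auto
  then show "\<exists>\<sigma>. diagonal_measure d \<sigma> \<and> emeasure \<sigma> (space \<sigma>) \<noteq> 0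
              \<and> ergodic \<sigma> (Tpow d) \<and> \<not> graph_joining d \<sigma>
              \<and> (\<exists>n0 D \<tau>. (n0, D, \<tau>) \<in> params d \<and> infinite {n. n \<ge> n0 \<and> corner_case d (\<tau> n)}
                            \<and> is_sigma d n0 D \<tau> \<sigma>)"
    using orbit_measure_diagonal sigma_properties(1,2)[OF d alt_params[OF assms] inf sigma]
      alt_params[OF assms] inf sigma by (intro exI[of _ orbit_measure]) auto
qed (use assms sigma_properties[of d] in simp)

end
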